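(* Let $\mathcal{A}$ be an operator algebra, $\rho:\mathcal{A}\to B(\mathcal{H})$ a representation, and $\theta:\mathrm{C}^*_{max}(\mathcal{A})\to B(\mathcal{H})$ the $*$-representation with $\theta\circ\mu=\rho$. Then $\rho$ is $*$-RFD if and only if $\theta$ is an RFD $*$-representation.
   Context: An operator algebra is a subalgebra of $B(\mathcal{H})$; a representation is a completely contractive algebra homomorphism. The maximal $\mathrm{C}^*$-cover $(\mathrm{C}^*_{max}(\mathcal{A}),\mu)$: $\mu$ is a completely isometric representation with $\mathrm{C}^*_{max}(\mathcal{A})=\mathrm{C}^*(\mu(\mathcal{A}))$ such that every representation $\rho$ of $\mathcal{A}$ lifts to a unique $*$-representation $\theta$ with $\theta\circ\mu=\rho$. A representation $\rho:\mathcal{A}\to B(\mathcal{H})$ is $*$-RFD if there is a net of representations $\rho_\lambda:\mathcal{A}\to B(\mathcal{H})$ with $\mathrm{C}^*(\rho_\lambda(\mathcal{A}))\mathcal{H}$ finite-dimensional, $\rho_\lambda(a)\to\rho(a)$ and $\rho_\lambda(a)^*\to\rho(a)^*$ strongly for all $a\in\mathcal{A}$. A $*$-representation $\pi$ of a $\mathrm{C}^*$-algebra $\mathfrak{A}$ on $\mathcal{H}$ is an RFD $*$-representation if there is a net of (possibly degenerate) $*$-representations $\pi_\lambda:\mathfrak{A}\to B(\mathcal{H})$ with $\pi_\lambda(\mathfrak{A})\mathcal{H}$ finite-dimensional and $\pi_\lambda(t)\to\pi(t)$ strongly for every $t\in\mathfrak{A}$. *)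

theory Defs
  imports "HOL-Analysis.Analysis"
begin

class complex_inner = real_normed_vector +
  fixes scaleC :: "complex \<Rightarrow> 'a \<Rightarrow> 'a" (infixr \<open>*\<^sub>C\<close> 75)
    and cinner :: "'a \<Rightarrow> 'a \<Rightarrow> complex"
  assumes scaleC_add_right: "a *\<^sub>C (x + y) = a *\<^sub>C x + a *\<^sub>C y"
    and scaleC_add_left: "(a + b) *\<^sub>C x = a *\<^sub>C x + b *\<^sub>C x"
    and scaleC_scaleC: "a *\<^sub>C (b *\<^sub>C x) = (a * b) *\<^sub>C x"
    and scaleC_one: "1 *\<^sub>C x = x"
    and scaleC_of_real: "complex_of_real r *\<^sub>C x = r *\<^sub>R x"
    and cinner_commute: "cinner x y = cnj (cinner y x)"
    and cinner_add_right: "cinner x (y + z) = cinner x y + cinner x z"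
    and cinner_scaleC_right: "cinner x (c *\<^sub>C y) = c * cinner x y"
    and cinner_self: "cinner x x = complex_of_real ((norm x)\<^sup>2)"

class chilbert_space = complex_inner + complete_space

definition clinear :: "('a::complex_inner \<Rightarrow> 'b::complex_inner) \<Rightarrow> bool" where
  "clinear T \<longleftrightarrow> (\<forall>x y. T (x + y) = T x + T y) \<and> (\<forall>c x. T (c *\<^sub>C x) = c *\<^sub>C T x)"

definition bdd_op :: "('a::complex_inner \<Rightarrow> 'a) \<Rightarrow> bool" where
  "bdd_op T \<longleftrightarrow> clinear T \<and> (\<exists>K. \<forall>x. norm (T x) \<le> K * norm x)"

definition adj :: "('a::complex_inner \<Rightarrow> 'a) \<Rightarrow> 'a \<Rightarrow> 'a" where
  "adj T y = (THE z. \<forall>x. cinner z x = cinner y (T x))"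

definition op_add :: "('a::complex_inner \<Rightarrow> 'a) \<Rightarrow> ('a \<Rightarrow> 'a) \<Rightarrow> 'a \<Rightarrow> 'a" where
  "op_add S T = (\<lambda>x. S x + T x)"

definition op_scale :: "complex \<Rightarrow> ('a::complex_inner \<Rightarrow> 'a) \<Rightarrow> 'a \<Rightarrow> 'a" where
  "op_scale c T = (\<lambda>x. c *\<^sub>C T x)"

definition op_algebra :: "('a::complex_inner \<Rightarrow> 'a) set \<Rightarrow> bool" where
  "op_algebra A \<longleftrightarrow> A \<subseteq> Collect bdd_op \<and> (\<lambda>x. 0) \<in> A
     \<and> (\<forall>S\<in>A. \<forall>T\<in>A. op_add S T \<in> A \<and> S \<circ> T \<in> A)
     \<and> (\<forall>c. \<forall>T\<in>A. op_scale c T \<in> A)"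

definition mat_norm :: "nat \<Rightarrow> (nat \<Rightarrow> nat \<Rightarrow> ('a::complex_inner \<Rightarrow> 'a)) \<Rightarrow> real" where
  "mat_norm n M = Sup {sqrt (\<Sum>i<n. (norm (\<Sum>j<n. M i j (x j)))\<^sup>2) | x.
                        (\<Sum>j<n. (norm (x j))\<^sup>2) \<le> 1}"

definition norm_closed :: "('a::complex_inner \<Rightarrow> 'a) set \<Rightarrow> bool" where
  "norm_closed B \<longleftrightarrow> (\<forall>T. bdd_op T \<and> (\<forall>e>0. \<exists>S\<in>B. onorm (\<lambda>x. T x - S x) < e) \<longrightarrow> T \<in> B)"

definition cstar_subalg :: "('a::complex_inner \<Rightarrow> 'a) set \<Rightarrow> bool" where
  "cstar_subalg B \<longleftrightarrow> op_algebra B \<and> (\<forall>T\<in>B. adj T \<in> B) \<and> norm_closed B"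

definition cstar_gen :: "('a::complex_inner \<Rightarrow> 'a) set \<Rightarrow> ('a \<Rightarrow> 'a) set" where
  "cstar_gen S = \<Inter>{B. cstar_subalg B \<and> S \<subseteq> B}"

definition cspan :: "'a::complex_inner set \<Rightarrow> 'a set" where
  "cspan F = {\<Sum>x\<in>F. c x *\<^sub>C x | c. True}"

text \<open>\<open>S H\<close> (closed linear span of \<open>{T h. T \<in> S, h \<in> H}\<close>) is finite-dimensional.\<close>
definition fin_dim_range :: "('a::complex_inner \<Rightarrow> 'a) set \<Rightarrow> bool" where
  "fin_dim_range S \<longleftrightarrow> (\<exists>F. finite F \<and> (\<forall>T\<in>S. \<forall>h. T h \<in> cspan F))"

definition alg_hom ::
  "('a::complex_inner \<Rightarrow> 'a) set \<Rightarrow> (('a \<Rightarrow> 'a) \<Rightarrow> ('b::complex_inner \<Rightarrow> 'b)) \<Rightarrow> bool" where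
  "alg_hom A \<rho> \<longleftrightarrow> (\<forall>S\<in>A. \<forall>T\<in>A. \<rho> (op_add S T) = op_add (\<rho> S) (\<rho> T)
                                 \<and> \<rho> (S \<circ> T) = \<rho> S \<circ> \<rho> T)
                   \<and> (\<forall>c. \<forall>T\<in>A. \<rho> (op_scale c T) = op_scale c (\<rho> T))"

definition representation ::
  "('a::complex_inner \<Rightarrow> 'a) set \<Rightarrow> (('a \<Rightarrow> 'a) \<Rightarrow> ('b::complex_inner \<Rightarrow> 'b)) \<Rightarrow> bool" where
  "representation A \<rho> \<longleftrightarrow> alg_hom A \<rho> \<and> (\<forall>T\<in>A. bdd_op (\<rho> T))
     \<and> (\<forall>n M. (\<forall>i<n. \<forall>j<n. M i j \<in> A) \<longrightarrow> mat_norm n (\<lambda>i j. \<rho> (M i j)) \<le> mat_norm n M)"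

definition compl_isometric_rep ::
  "('a::complex_inner \<Rightarrow> 'a) set \<Rightarrow> (('a \<Rightarrow> 'a) \<Rightarrow> ('b::complex_inner \<Rightarrow> 'b)) \<Rightarrow> bool" where
  "compl_isometric_rep A \<rho> \<longleftrightarrow> alg_hom A \<rho> \<and> (\<forall>T\<in>A. bdd_op (\<rho> T))
     \<and> (\<forall>n M. (\<forall>i<n. \<forall>j<n. M i j \<in> A) \<longrightarrow> mat_norm n (\<lambda>i j. \<rho> (M i j)) = mat_norm n M)"

text \<open>*-representation of a (concrete) C*-algebra \<open>C \<subseteq> B(K)\<close> on \<open>H\<close> (possibly degenerate).\<close>
definition star_rep ::
  "('a::complex_inner \<Rightarrow> 'a) set \<Rightarrow> (('a \<Rightarrow> 'a) \<Rightarrow> ('b::complex_inner \<Rightarrow> 'b)) \<Rightarrow> bool" where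
  "star_rep C \<theta> \<longleftrightarrow> alg_hom C \<theta> \<and> (\<forall>T\<in>C. bdd_op (\<theta> T)) \<and> (\<forall>T\<in>C. \<theta> (adj T) = adj (\<theta> T))"

text \<open>Maximal C*-cover \<open>(C, \<mu>)\<close> of \<open>A\<close>, with \<open>C\<close> realised concretely inside \<open>B(K')\<close>.
  The universal property is asserted for representations on Hilbert spaces of type \<open>'h\<close>.\<close>
definition max_cstar_cover ::
  "('a::complex_inner \<Rightarrow> 'a) set \<Rightarrow> ('c::complex_inner \<Rightarrow> 'c) set \<Rightarrow> (('a \<Rightarrow> 'a) \<Rightarrow> ('c \<Rightarrow> 'c))
     \<Rightarrow> 'h::complex_inner itself \<Rightarrow> bool" where
  "max_cstar_cover A C \<mu> _ \<longleftrightarrow> compl_isometric_rep A \<mu> \<and> C = cstar_gen (\<mu> ` A)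
     \<and> (\<forall>\<rho> :: ('a \<Rightarrow> 'a) \<Rightarrow> ('h \<Rightarrow> 'h). representation A \<rho> \<longrightarrow>
          (\<exists>\<theta>. star_rep C \<theta> \<and> (\<forall>T\<in>A. \<theta> (\<mu> T) = \<rho> T))
        \<and> (\<forall>\<theta>1 \<theta>2. star_rep C \<theta>1 \<and> star_rep C \<theta>2 \<and> (\<forall>T\<in>A. \<theta>1 (\<mu> T) = \<rho> T)
              \<and> (\<forall>T\<in>A. \<theta>2 (\<mu> T) = \<rho> T) \<longrightarrow> (\<forall>S\<in>C. \<theta>1 S = \<theta>2 S)))"

text \<open>Nets are rendered as proper filters on the space of maps (the filter of tails of the net).\<close>
definition star_RFD ::
  "('a::complex_inner \<Rightarrow> 'a) set \<Rightarrow> (('a \<Rightarrow> 'a) \<Rightarrow> ('b::complex_inner \<Rightarrow> 'b)) \<Rightarrow> bool" where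
  "star_RFD A \<rho> \<longleftrightarrow> (\<exists>F :: (('a \<Rightarrow> 'a) \<Rightarrow> ('b \<Rightarrow> 'b)) filter. F \<noteq> bot
     \<and> eventually (\<lambda>r. representation A r \<and> fin_dim_range (cstar_gen (r ` A))) F
     \<and> (\<forall>T\<in>A. \<forall>h. ((\<lambda>r. r T h) \<longlongrightarrow> \<rho> T h) F
                 \<and> ((\<lambda>r. adj (r T) h) \<longlongrightarrow> adj (\<rho> T) h) F))"

definition RFD_star_rep ::
  "('a::complex_inner \<Rightarrow> 'a) set \<Rightarrow> (('a \<Rightarrow> 'a) \<Rightarrow> ('b::complex_inner \<Rightarrow> 'b)) \<Rightarrow> bool" where
  "RFD_star_rep C \<pi> \<longleftrightarrow> (\<exists>F :: (('a \<Rightarrow> 'a) \<Rightarrow> ('b \<Rightarrow> 'b)) filter. F \<noteq> bot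
     \<and> eventually (\<lambda>p. star_rep C p \<and> fin_dim_range (p ` C)) F
     \<and> (\<forall>T\<in>C. \<forall>h. ((\<lambda>p. p T h) \<longlongrightarrow> \<pi> T h) F))"

end

theory Submission
  imports Defs
begin

text \<open>The two kinds of approximating nets are translated into each other by restricting
  *-representations of \<open>C\<^sup>*\<^sub>m\<^sub>a\<^sub>x\<close> along \<open>\<mu>\<close> and by lifting representations of \<open>A\<close>. Both directions rest on
  the complete contractivity of *-representations. It makes the restrictions representations, and it
  makes the set of elements on which a net of *-representations converges strongly a norm-closed
  algebra. Convergence of the operators and of their adjoints on \<open>A\<close> says that this algebra contains
  \<open>\<mu>(A)\<close> and its adjoints, so it is everything. Finite-dimensionality passes between a self-adjoint set
  of operators and the C*-algebra it generates because both have the same common kernel.\<close>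

section \<open>Complex inner product spaces\<close>

interpretation complex_vector: vector_space "scaleC :: complex \<Rightarrow> 'a \<Rightarrow> 'a::complex_inner"
  by unfold_locales (auto simp: scaleC_add_right scaleC_add_left scaleC_scaleC scaleC_one)

lemma cinner_add_left:
  fixes x y z :: "'a::complex_inner"
  shows "cinner (x + y) z = cinner x z + cinner y z"
  by (metis cinner_commute cinner_add_right complex_cnj_add)

lemma cinner_scaleC_left:
  fixes x y :: "'a::complex_inner"
  shows "cinner (c *\<^sub>C x) y = cnj c * cinner x y"
  by (metis cinner_commute cinner_scaleC_right complex_cnj_mult)

lemma norm_sq_cinner:
  fixes x :: "'a::complex_inner"
  shows "(norm x)\<^sup>2 = Re (cinner x x)"
  by (simp add: cinner_self)

lemma Re_cinner_commute:
  fixes x y :: "'a::complex_inner"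
  shows "Re (cinner x y) = Re (cinner y x)"
  by (subst cinner_commute) simp

lemma norm_add_sq:
  fixes x y :: "'a::complex_inner"
  shows "(norm (x + y))\<^sup>2 = (norm x)\<^sup>2 + 2 * Re (cinner x y) + (norm y)\<^sup>2"
  using Re_cinner_commute[of x y]
  by (simp add: norm_sq_cinner cinner_add_left cinner_add_right)

lemma norm_scaleC:
  fixes x :: "'a::complex_inner"
  shows "norm (c *\<^sub>C x) = cmod c * norm x"
proof (rule power2_eq_imp_eq)
  have "(norm (c *\<^sub>C x))\<^sup>2 = Re ((c * cnj c) * cinner x x)"
    by (simp add: norm_sq_cinner cinner_scaleC_left cinner_scaleC_right mult_ac)
  also have "\<dots> = (cmod c * norm x)\<^sup>2"
    by (simp add: complex_norm_square[symmetric] cinner_self power_mult_distrib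
        flip: of_real_power of_real_mult)
  finally show "(norm (c *\<^sub>C x))\<^sup>2 = (cmod c * norm x)\<^sup>2" .
qed auto

lemma Cauchy_Schwarz_cinner:
  fixes x y :: "'a::complex_inner"
  shows "cmod (cinner x y) \<le> norm x * norm y"
proof (cases "y = 0")
  case True
  have "cinner x 0 = 0" by (metis add_cancel_left_left cinner_add_right)
  with True show ?thesis by simp
next
  case False
  define c where "c = - (cinner y x / of_real ((norm y)\<^sup>2))"
  have y: "(norm y)\<^sup>2 \<noteq> 0" using False by simp
  have xy: "cinner x y = cnj (cinner y x)" by (rule cinner_commute)
  have "0 \<le> (norm (x + c *\<^sub>C y))\<^sup>2" by simp
  also have "\<dots> = (norm x)\<^sup>2 + 2 * Re (c * cinner x y) + (cmod c * norm y)\<^sup>2"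
    by (simp add: norm_add_sq norm_scaleC cinner_scaleC_right)
  also have "c * cinner x y = - of_real ((cmod (cinner y x))\<^sup>2 / (norm y)\<^sup>2)"
    by (simp add: c_def xy complex_norm_square del: of_real_power)
  also have "(cmod c * norm y)\<^sup>2 = (cmod (cinner y x))\<^sup>2 / (norm y)\<^sup>2"
    using y
    by (simp add: c_def norm_divide norm_power power_divide power2_eq_square del: of_real_mult)
  finally have "(cmod (cinner y x))\<^sup>2 \<le> (norm x * norm y)\<^sup>2"
    using y by (simp add: divide_simps power_mult_distrib)
  then have "cmod (cinner y x) \<le> norm x * norm y"
    by (rule power2_le_imp_le) simp
  then show ?thesis by (simp add: xy)
qed

interpretation cinner: bounded_bilinear "cinner :: 'a \<Rightarrow> 'a::complex_inner \<Rightarrow> complex"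
proof
  fix r :: real and x y :: 'a
  show "cinner (r *\<^sub>R x) y = r *\<^sub>R cinner x y"
    by (metis cinner_scaleC_left complex_cnj_complex_of_real scaleC_of_real scaleR_conv_of_real)
  show "cinner x (r *\<^sub>R y) = r *\<^sub>R cinner x y"
    by (metis cinner_scaleC_right scaleC_of_real scaleR_conv_of_real)
  show "\<exists>K. \<forall>x y. norm (cinner (x::'a) y) \<le> norm x * norm y * K"
    using Cauchy_Schwarz_cinner by (intro exI[of _ 1]) auto
qed (simp_all add: cinner_add_left cinner_add_right)

lemma Re_cinner_le:
  fixes x y :: "'a::complex_inner"
  shows "Re (cinner x y) \<le> norm x * norm y"
  using complex_Re_le_cmod Cauchy_Schwarz_cinner order_trans by blast

lemma norm_diff_sq:
  fixes x y :: "'a::complex_inner"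
  shows "(norm (x - y))\<^sup>2 = (norm x)\<^sup>2 - 2 * Re (cinner x y) + (norm y)\<^sup>2"
  using norm_add_sq[of x "- y"] by (simp add: cinner.minus_right)

lemma cinner_eqI:
  fixes z w :: "'a::complex_inner"
  assumes "\<And>x. cinner z x = cinner w x"
  shows "z = w"
proof -
  have "cinner (z - w) (z - w) = 0"
    by (simp only: cinner.diff_left assms) simp
  then show ?thesis by (simp add: cinner_self)
qed

lemma bounded_linear_scaleC: "bounded_linear (\<lambda>x::'a::complex_inner. c *\<^sub>C x)"
proof (rule bounded_linear_intro[of _ "cmod c"])
  show "c *\<^sub>C (r *\<^sub>R x) = r *\<^sub>R (c *\<^sub>C x)" for r and x :: 'a
    by (metis scaleC_of_real scaleC_scaleC mult.commute)
qed (auto simp: scaleC_add_right norm_scaleC)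

lemma complex_span_finite:
  fixes F :: "'a::complex_inner set"
  assumes "finite F"
  shows "cspan F = complex_vector.span F"
  unfolding cspan_def complex_vector.span_finite[OF assms] by auto

lemma in_cspanI_biorthogonal:
  fixes F :: "'a::complex_inner set"
  assumes "finite F" and "\<And>y. (\<And>f. f \<in> F \<Longrightarrow> cinner f y = 0) \<Longrightarrow> cinner x y = 0"
  shows "x \<in> cspan F"
  unfolding complex_span_finite[OF assms(1)] using assms
proof (induction F arbitrary: x)
  case empty
  have "cinner x x = 0" by (rule empty) simp
  then show ?case by (simp add: cinner_self)
next
  case (insert f F)
  show ?case
  proof (cases "\<exists>y. (\<forall>g\<in>F. cinner g y = 0) \<and> cinner f y \<noteq> 0")
    case False
    then have "x \<in> complex_vector.span F" by (intro insert) auto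
    then show ?thesis using complex_vector.span_mono[of F "insert f F"] by blast
  next
    case True
    then obtain y where y: "\<And>g. g \<in> F \<Longrightarrow> cinner g y = 0" "cinner f y \<noteq> 0" by blast
    define c where "c = cnj (cinner x y / cinner f y)"
    have "x - c *\<^sub>C f \<in> complex_vector.span F"
    proof (rule insert.IH)
      fix z assume z: "\<And>g. g \<in> F \<Longrightarrow> cinner g z = 0"
      have "cinner x (z - (cinner f z / cinner f y) *\<^sub>C y) = 0"
        using y z by (intro insert.prems) (auto simp: cinner.diff_right cinner_scaleC_right)
      then show "cinner (x - c *\<^sub>C f) z = 0"
        by (simp add: cinner.diff_left cinner.diff_right cinner_scaleC_left cinner_scaleC_right
            c_def)
    qed
    then show ?thesis using complex_vector.span_breakdown_eq by blast
  qed
qed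

section \<open>Bounded operators and adjoints\<close>

subclass (in chilbert_space) banach ..

lemma bdd_op_iff: "bdd_op T \<longleftrightarrow> bounded_linear T \<and> (\<forall>c x. T (c *\<^sub>C x) = c *\<^sub>C T x)"
proof
  assume T: "bdd_op T"
  then obtain K where K: "\<And>x. norm (T x) \<le> norm x * K"
    by (auto simp: bdd_op_def mult.commute)
  have add: "T (x + y) = T x + T y" and scale: "T (c *\<^sub>C x) = c *\<^sub>C T x" for x y c
    using T by (auto simp: bdd_op_def clinear_def)
  have "T (r *\<^sub>R x) = r *\<^sub>R T x" for r x
    by (metis scale scaleC_of_real)
  then have "bounded_linear T" by (intro bounded_linear_intro[of _ K] add K)
  with scale show "bounded_linear T \<and> (\<forall>c x. T (c *\<^sub>C x) = c *\<^sub>C T x)" by blast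
next
  assume T: "bounded_linear T \<and> (\<forall>c x. T (c *\<^sub>C x) = c *\<^sub>C T x)"
  then have "norm (T x) \<le> onorm T * norm x" for x by (simp add: onorm)
  with T show "bdd_op T"
    unfolding bdd_op_def clinear_def by (metis linear_add bounded_linear.linear)
qed

lemma bdd_op_bounded_linear: "bdd_op T \<Longrightarrow> bounded_linear T"
  and bdd_op_scaleC: "bdd_op T \<Longrightarrow> T (c *\<^sub>C x) = c *\<^sub>C T x"
  by (simp_all add: bdd_op_iff)

lemmas bdd_op_linear = bdd_op_bounded_linear[THEN bounded_linear.linear]
  and bdd_op_norm_le = bdd_op_bounded_linear[THEN onorm]

lemma op_add_apply [simp]: "op_add S T x = S x + T x"
  and op_scale_apply [simp]: "op_scale c T x = c *\<^sub>C T x"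
  by (simp_all add: op_add_def op_scale_def)

lemma bdd_op_zero: "bdd_op (\<lambda>x. 0)"
  by (simp add: bdd_op_iff)

lemma bdd_op_op_add: "bdd_op S \<Longrightarrow> bdd_op T \<Longrightarrow> bdd_op (op_add S T)"
  by (simp add: bdd_op_iff op_add_def bounded_linear_add scaleC_add_right)

lemma bdd_op_op_scale: "bdd_op T \<Longrightarrow> bdd_op (op_scale c T)"
  by (simp add: bdd_op_iff op_scale_def bounded_linear_compose[OF bounded_linear_scaleC]
      scaleC_scaleC mult.commute)

lemma bdd_op_comp: "bdd_op S \<Longrightarrow> bdd_op T \<Longrightarrow> bdd_op (S \<circ> T)"
  by (simp add: bdd_op_iff bounded_linear_compose comp_def)

lemma diff_eq_op_add: "S - T = op_add S (op_scale (-1) T)"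
  by (simp add: fun_eq_iff scaleC_one)

lemma bdd_op_diff: "bdd_op S \<Longrightarrow> bdd_op T \<Longrightarrow> bdd_op (S - T)"
  by (simp add: diff_eq_op_add bdd_op_op_add bdd_op_op_scale)

text \<open>The hypothesis on \<open>J\<close> makes every minimising sequence Cauchy.\<close>

lemma uniformly_convex_attains_min:
  fixes J :: "'a::banach \<Rightarrow> real"
  assumes bdd: "bdd_below (range J)" and cont: "continuous_on UNIV J"
    and convex: "\<And>x y. (norm (x - y))\<^sup>2 \<le> 2 * J x + 2 * J y - 4 * J ((1/2) *\<^sub>R (x + y))"
  shows "\<exists>z. \<forall>x. J z \<le> J x"
proof -
  define d where "d = Inf (range J)"
  have lower: "d \<le> J x" for x unfolding d_def by (intro cInf_lower bdd) auto
  have "\<exists>x. J x < d + 1 / Suc n" for n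
    using cInf_less_iff[of "range J" "d + 1 / Suc n"] bdd by (auto simp: d_def)
  then obtain X where X: "\<And>n. J (X n) < d + 1 / Suc n" by metis
  have close: "(norm (X m - X n))\<^sup>2 < 4 / Suc N" if "m \<ge> N" "n \<ge> N" for m n N
  proof -
    have "1 / real (Suc m) \<le> 1 / Suc N" "1 / real (Suc n) \<le> 1 / Suc N"
      using that by (auto simp: field_simps)
    then show ?thesis
      using X[of m] X[of n] lower[of "(1/2) *\<^sub>R (X m + X n)"] convex[of "X m" "X n"] by simp
  qed
  have "Cauchy X"
  proof (rule metric_CauchyI)
    fix e :: real assume "e > 0"
    then obtain N where N: "4 / real (Suc N) < e\<^sup>2"
      using reals_Archimedean[of "e\<^sup>2 / 4"] by (auto simp: inverse_eq_divide)
    have "dist (X m) (X n) < e" if "m \<ge> N" "n \<ge> N" for m n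
      unfolding dist_norm
      using less_trans[OF close[OF that] N] \<open>e > 0\<close> by (simp add: power2_less_imp_less)
    then show "\<exists>M. \<forall>m\<ge>M. \<forall>n\<ge>M. dist (X m) (X n) < e" by blast
  qed
  then obtain z where "X \<longlonglongrightarrow> z" using Cauchy_convergent convergent_def by blast
  then have "(\<lambda>n. J (X n)) \<longlonglongrightarrow> J z"
    by (intro continuous_on_tendsto_compose[OF cont]) auto
  moreover have "(\<lambda>n. d + 1 / real (Suc n)) \<longlonglongrightarrow> d"
    using tendsto_add[OF tendsto_const[of d] lim_inverse_n'[THEN LIMSEQ_Suc]] by simp
  ultimately have "J z \<le> d"
    by (rule LIMSEQ_le) (use X less_imp_le in blast)
  then show ?thesis using lower order_trans by blast
qed

lemma Re_cinner_eq_of_minimizer: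
  fixes g :: "'a::complex_inner \<Rightarrow> real"
  assumes g: "bounded_linear g"
    and min: "\<And>x. (norm z)\<^sup>2 - 2 * g z \<le> (norm x)\<^sup>2 - 2 * g x"
  shows "Re (cinner z w) = g w"
proof -
  interpret g: bounded_linear g by fact
  define gap where "gap = Re (cinner z w) - g w"
  define b where "b = (norm w)\<^sup>2 + 1"
  define t where "t = - gap / b"
  have b_pos: "b > 0" by (simp add: b_def add_nonneg_pos)
  have "(norm (z + t *\<^sub>R w))\<^sup>2 - 2 * g (z + t *\<^sub>R w)
      = (norm z)\<^sup>2 - 2 * g z + 2 * t * gap + t\<^sup>2 * (norm w)\<^sup>2"
    by (simp add: norm_add_sq g.add g.scaleR cinner.scaleR_right gap_def power_mult_distrib
        algebra_simps)
  then have "0 \<le> 2 * t * gap + t\<^sup>2 * (norm w)\<^sup>2"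
    using min[of "z + t *\<^sub>R w"] by linarith
  also have "\<dots> \<le> 2 * t * gap + t\<^sup>2 * b" by (simp add: b_def algebra_simps)
  also have "\<dots> = - gap\<^sup>2 / b"
    using b_pos by (simp add: t_def field_simps power2_eq_square)
  finally show ?thesis using b_pos by (simp add: gap_def divide_le_0_iff zero_le_divide_iff)
qed

lemma Re_Riesz_representation:
  fixes g :: "'a::chilbert_space \<Rightarrow> real"
  assumes g: "bounded_linear g"
  shows "\<exists>z. \<forall>x. Re (cinner z x) = g x"
proof -
  interpret g: bounded_linear g by fact
  define J where "J x = (norm x)\<^sup>2 - 2 * g x" for x
  have "\<exists>z. \<forall>x. J z \<le> J x"
  proof (rule uniformly_convex_attains_min)
    have "- (onorm g)\<^sup>2 \<le> J x" for x
    proof -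
      have "g x \<le> onorm g * norm x" using onorm[OF g, of x] by simp
      moreover have "0 \<le> (norm x - onorm g)\<^sup>2" by simp
      ultimately show ?thesis by (simp add: J_def power2_eq_square algebra_simps)
    qed
    then show "bdd_below (range J)" by (auto intro: bdd_belowI[of _ "- (onorm g)\<^sup>2"])
    show "continuous_on UNIV J"
      unfolding J_def by (intro continuous_intros g.continuous_on)
    show "(norm (x - y))\<^sup>2 \<le> 2 * J x + 2 * J y - 4 * J ((1/2) *\<^sub>R (x + y))" for x y
      using norm_add_sq[of x y] norm_diff_sq[of x y]
      by (simp add: J_def g.scaleR g.add power_mult_distrib power_divide del: scaleR_add_right)
         (simp add: field_simps)
  qed
  then show ?thesis unfolding J_def using Re_cinner_eq_of_minimizer[OF g] by blast
qed

lemma Riesz_representation: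
  fixes f :: "'a::chilbert_space \<Rightarrow> complex"
  assumes f: "bounded_linear f" and scale: "\<And>c x. f (c *\<^sub>C x) = c * f x"
  shows "\<exists>z. \<forall>x. cinner z x = f x"
proof -
  have "bounded_linear (\<lambda>x. Re (f x))"
    by (rule bounded_linear_compose[OF bounded_linear_Re f])
  then obtain z where z: "\<And>x. Re (cinner z x) = Re (f x)"
    using Re_Riesz_representation by blast
  have "cinner z x = f x" for x
    using z[of x] z[of "\<i> *\<^sub>C x"] by (simp add: complex_eq_iff scale cinner_scaleC_right)
  then show ?thesis by blast
qed

lemma adj_eqI:
  assumes "\<And>x y. cinner (S y) x = cinner y (T x)"
  shows "adj T = S"
proof
  fix y show "adj T y = S y"
    unfolding adj_def by (rule the_equality) (auto simp: assms intro: cinner_eqI)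
qed

lemma cinner_adj_left:
  fixes T :: "'a::chilbert_space \<Rightarrow> 'a"
  assumes T: "bdd_op T"
  shows "cinner (adj T y) x = cinner y (T x)"
proof -
  have "bounded_linear (\<lambda>x. cinner y (T x))"
    by (rule bounded_linear_compose[OF cinner.bounded_linear_right bdd_op_bounded_linear[OF T]])
  then obtain z where z: "\<And>x. cinner z x = cinner y (T x)"
    using Riesz_representation[of "\<lambda>x. cinner y (T x)"]
    by (auto simp: bdd_op_scaleC[OF T] cinner_scaleC_right)
  then have "adj T y = z"
    unfolding adj_def by (intro the_equality) (auto intro: cinner_eqI)
  with z show ?thesis by simp
qed

lemma cinner_adj_right:
  fixes T :: "'a::chilbert_space \<Rightarrow> 'a"
  assumes "bdd_op T"
  shows "cinner x (adj T y) = cinner (T x) y"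
  using arg_cong[OF cinner_adj_left[OF assms, of y x], of cnj]
  by (simp add: cinner_commute[symmetric])

lemma norm_adj_le:
  fixes T :: "'a::chilbert_space \<Rightarrow> 'a"
  assumes T: "bdd_op T"
  shows "norm (adj T y) \<le> onorm T * norm y"
proof -
  have "(norm (adj T y))\<^sup>2 = Re (cinner y (T (adj T y)))"
    by (simp add: norm_sq_cinner cinner_adj_left[OF T])
  also have "\<dots> \<le> norm y * norm (T (adj T y))" by (rule Re_cinner_le)
  also have "\<dots> \<le> norm y * (onorm T * norm (adj T y))"
    by (intro mult_left_mono bdd_op_norm_le[OF T]) auto
  finally have "norm (adj T y) * norm (adj T y) \<le> (onorm T * norm y) * norm (adj T y)"
    by (simp add: power2_eq_square mult_ac)
  moreover have "0 \<le> onorm T" by (rule onorm_pos_le[OF bdd_op_bounded_linear[OF T]])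
  ultimately show ?thesis by (cases "adj T y = 0") auto
qed

lemma bdd_op_adj:
  fixes T :: "'a::chilbert_space \<Rightarrow> 'a"
  assumes T: "bdd_op T"
  shows "bdd_op (adj T)"
proof -
  have "adj T (x + y) = adj T x + adj T y" for x y
    by (rule cinner_eqI) (simp add: cinner_adj_left[OF T] cinner_add_left)
  moreover have "adj T (c *\<^sub>C x) = c *\<^sub>C adj T x" for c x
    by (rule cinner_eqI) (simp add: cinner_adj_left[OF T] cinner_scaleC_left)
  ultimately show ?thesis
    unfolding bdd_op_def clinear_def using norm_adj_le[OF T] by blast
qed

lemma onorm_adj_le:
  fixes T :: "'a::chilbert_space \<Rightarrow> 'a"
  shows "bdd_op T \<Longrightarrow> onorm (adj T) \<le> onorm T"
  by (intro onorm_bound norm_adj_le onorm_pos_le bdd_op_bounded_linear)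

lemma adj_adj:
  fixes T :: "'a::chilbert_space \<Rightarrow> 'a"
  shows "bdd_op T \<Longrightarrow> adj (adj T) = T"
  by (rule adj_eqI) (simp add: cinner_adj_right)

lemma adj_zero: "adj (\<lambda>x. 0) = (\<lambda>x. 0)"
  by (rule adj_eqI) (simp add: cinner.zero_left cinner.zero_right)

lemma adj_op_add:
  fixes S T :: "'a::chilbert_space \<Rightarrow> 'a"
  shows "bdd_op S \<Longrightarrow> bdd_op T \<Longrightarrow> adj (op_add S T) = op_add (adj S) (adj T)"
  by (rule adj_eqI) (simp add: cinner_add_left cinner_add_right cinner_adj_left)

lemma adj_op_scale:
  fixes T :: "'a::chilbert_space \<Rightarrow> 'a"
  shows "bdd_op T \<Longrightarrow> adj (op_scale c T) = op_scale (cnj c) (adj T)"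
  by (rule adj_eqI) (simp add: cinner_scaleC_left cinner_scaleC_right cinner_adj_left)

lemma adj_comp:
  fixes S T :: "'a::chilbert_space \<Rightarrow> 'a"
  shows "bdd_op S \<Longrightarrow> bdd_op T \<Longrightarrow> adj (S \<circ> T) = adj T \<circ> adj S"
  by (rule adj_eqI) (simp add: cinner_adj_left)

lemma adj_diff:
  fixes S T :: "'a::chilbert_space \<Rightarrow> 'a"
  shows "bdd_op S \<Longrightarrow> bdd_op T \<Longrightarrow> adj (S - T) = adj S - adj T"
  by (simp add: diff_eq_op_add adj_op_add adj_op_scale bdd_op_op_scale)

section \<open>Norm-closed operator algebras\<close>

definition closed_op_algebra :: "('a::complex_inner \<Rightarrow> 'a) set \<Rightarrow> bool" where
  "closed_op_algebra A \<longleftrightarrow> op_algebra A \<and> norm_closed A"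

lemma norm_closed_iff:
  "norm_closed A \<longleftrightarrow> (\<forall>T. bdd_op T \<and> (\<forall>e>0. \<exists>S\<in>A. onorm (T - S) < e) \<longrightarrow> T \<in> A)"
  by (simp add: norm_closed_def fun_diff_def)

lemma op_algebraD:
  assumes "op_algebra A"
  shows op_algebra_bdd: "T \<in> A \<Longrightarrow> bdd_op T"
    and op_algebra_zero: "(\<lambda>x. 0) \<in> A"
    and op_algebra_add: "S \<in> A \<Longrightarrow> T \<in> A \<Longrightarrow> op_add S T \<in> A"
    and op_algebra_comp: "S \<in> A \<Longrightarrow> T \<in> A \<Longrightarrow> S \<circ> T \<in> A"
    and op_algebra_scale: "T \<in> A \<Longrightarrow> op_scale c T \<in> A"
  using assms unfolding op_algebra_def by auto

lemma op_algebra_diff: "op_algebra A \<Longrightarrow> S \<in> A \<Longrightarrow> T \<in> A \<Longrightarrow> S - T \<in> A"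
  by (simp add: diff_eq_op_add op_algebra_add op_algebra_scale)

lemma op_algebra_sum:
  assumes A: "op_algebra A" and "finite I" "\<And>i. i \<in> I \<Longrightarrow> T i \<in> A"
  shows "(\<lambda>x. \<Sum>i\<in>I. T i x) \<in> A"
  using assms(2,3)
proof (induction I)
  case (insert i I)
  then have "op_add (T i) (\<lambda>x. \<Sum>i\<in>I. T i x) \<in> A" by (intro op_algebra_add A) auto
  then show ?case using insert.hyps by (simp add: op_add_def)
qed (simp add: op_algebra_zero A)

lemma closed_op_algebraI:
  assumes "\<And>T. T \<in> A \<Longrightarrow> bdd_op T" "(\<lambda>x. 0) \<in> A"
    and "\<And>S T. S \<in> A \<Longrightarrow> T \<in> A \<Longrightarrow> op_add S T \<in> A"
    and "\<And>S T. S \<in> A \<Longrightarrow> T \<in> A \<Longrightarrow> S \<circ> T \<in> A"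
    and "\<And>c T. T \<in> A \<Longrightarrow> op_scale c T \<in> A"
    and "\<And>T. bdd_op T \<Longrightarrow> (\<And>e. e > 0 \<Longrightarrow> \<exists>S\<in>A. onorm (T - S) < e) \<Longrightarrow> T \<in> A"
  shows "closed_op_algebra A"
proof -
  have "norm_closed A" unfolding norm_closed_iff using assms(6) by simp
  then show ?thesis using assms(1-5) by (auto simp: closed_op_algebra_def op_algebra_def)
qed

lemma closed_op_algebraD:
  assumes "closed_op_algebra A"
  shows closed_op_algebra_op_algebra: "op_algebra A"
    and closed_op_algebra_limit:
      "bdd_op T \<Longrightarrow> (\<And>e. e > 0 \<Longrightarrow> \<exists>S\<in>A. onorm (T - S) < e) \<Longrightarrow> T \<in> A"
  using assms by (simp_all add: closed_op_algebra_def norm_closed_iff)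

lemma norm_approx_imp_pointwise_approx:
  assumes appr: "\<And>e. e > 0 \<Longrightarrow> \<exists>S\<in>A. onorm (T - S) < e" and e: "e > 0"
  shows "\<exists>S\<in>A. onorm (T - S) * norm h < e"
proof -
  have pos: "0 < norm h + 1" by (simp add: add_nonneg_pos)
  then obtain S where S: "S \<in> A" "onorm (T - S) < e / (norm h + 1)"
    using appr[of "e / (norm h + 1)"] e by auto
  have "onorm (T - S) * norm h \<le> e / (norm h + 1) * norm h"
    using S(2) by (intro mult_right_mono) auto
  also have "\<dots> < e" using e pos by (simp add: field_simps)
  finally show ?thesis using S(1) by blast
qed

lemma closed_op_algebra_bdd_ops: "closed_op_algebra (Collect bdd_op)"
  by (rule closed_op_algebraI) (auto simp: bdd_op_zero bdd_op_op_add bdd_op_comp bdd_op_op_scale)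

lemma closed_op_algebra_suminf:
  fixes T :: "nat \<Rightarrow> 'a::chilbert_space \<Rightarrow> 'a"
  assumes A: "closed_op_algebra A" and T: "\<And>k. T k \<in> A" and summable: "summable (\<lambda>k. onorm (T k))"
  obtains L where "L \<in> A" "\<And>x. (\<lambda>k. T k x) sums L x"
proof -
  note alg = closed_op_algebra_op_algebra[OF A]
  note bdd = op_algebra_bdd[OF alg T]
  define f where "f k = Blinfun (T k)" for k
  have f: "blinfun_apply (f k) = T k" for k
    by (simp add: f_def bounded_linear_Blinfun_apply bdd_op_bounded_linear bdd)
  have "summable f"
    by (rule summable_norm_cancel) (simp add: norm_blinfun.rep_eq f summable)
  then obtain l where l: "f sums l" by blast
  have lim: "(\<lambda>k. T k x) sums l x" for x
    using bounded_linear.sums[OF bounded_linear_apply_blinfun l] by (simp add: f)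
  show thesis
  proof (rule that[OF _ lim], rule closed_op_algebra_limit[OF A])
    have "l (c *\<^sub>C x) = c *\<^sub>C l x" for c x
      using sums_unique2[OF lim[of "c *\<^sub>C x"]] bounded_linear.sums[OF bounded_linear_scaleC lim]
      by (simp add: bdd_op_scaleC[OF bdd])
    then show "bdd_op (blinfun_apply l)"
      by (simp add: bdd_op_iff bounded_linear_blinfun_apply)
    fix e :: real assume "e > 0"
    then obtain m where "norm (l - (\<Sum>k<m. f k)) < e"
      using l LIMSEQ_iff norm_minus_commute unfolding sums_def by (metis order_refl)
    moreover have "blinfun_apply (l - (\<Sum>k<m. f k)) = blinfun_apply l - (\<lambda>x. \<Sum>k<m. T k x)"
      by (simp add: fun_eq_iff blinfun.diff_left blinfun.sum_left f)
    ultimately show "\<exists>S\<in>A. onorm (blinfun_apply l - S) < e"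
      using op_algebra_sum[OF alg, of "{..<m}" T] T by (auto simp: norm_blinfun.rep_eq)
  qed
qed

section \<open>Matrices of operators\<close>

definition vec_norm :: "nat \<Rightarrow> (nat \<Rightarrow> 'a::complex_inner) \<Rightarrow> real" where
  "vec_norm n x = L2_set (\<lambda>i. norm (x i)) {..<n}"

definition vec_inner :: "nat \<Rightarrow> (nat \<Rightarrow> 'a::complex_inner) \<Rightarrow> (nat \<Rightarrow> 'a) \<Rightarrow> complex" where
  "vec_inner n x y = (\<Sum>i<n. cinner (x i) (y i))"

definition matrices_over :: "nat \<Rightarrow> 'b set \<Rightarrow> (nat \<Rightarrow> nat \<Rightarrow> 'b) set" where
  "matrices_over n A = {M. \<forall>i<n. \<forall>j<n. M i j \<in> A}"

abbreviation op_matrices :: "nat \<Rightarrow> (nat \<Rightarrow> nat \<Rightarrow> 'a::complex_inner \<Rightarrow> 'a) set" where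
  "op_matrices n \<equiv> matrices_over n (Collect bdd_op)"

definition mat_app ::
  "nat \<Rightarrow> (nat \<Rightarrow> nat \<Rightarrow> 'a \<Rightarrow> 'a) \<Rightarrow> (nat \<Rightarrow> 'a) \<Rightarrow> nat \<Rightarrow> 'a::complex_inner" where
  "mat_app n M x i = (\<Sum>j<n. M i j (x j))"

definition mat_mult ::
  "nat \<Rightarrow> (nat \<Rightarrow> nat \<Rightarrow> 'a \<Rightarrow> 'a) \<Rightarrow> (nat \<Rightarrow> nat \<Rightarrow> 'a \<Rightarrow> 'a) \<Rightarrow> nat \<Rightarrow> nat \<Rightarrow> 'a \<Rightarrow> 'a::complex_inner"
  where "mat_mult n M N i j = (\<lambda>x. \<Sum>l<n. (M i l \<circ> N l j) x)"

definition mat_scale ::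
  "real \<Rightarrow> (nat \<Rightarrow> nat \<Rightarrow> 'a \<Rightarrow> 'a) \<Rightarrow> nat \<Rightarrow> nat \<Rightarrow> 'a \<Rightarrow> 'a::complex_inner" where
  "mat_scale r M i j = op_scale (complex_of_real r) (M i j)"

definition mat_adj ::
  "(nat \<Rightarrow> nat \<Rightarrow> 'a \<Rightarrow> 'a) \<Rightarrow> nat \<Rightarrow> nat \<Rightarrow> 'a \<Rightarrow> 'a::complex_inner" where
  "mat_adj M i j = adj (M j i)"

lemma vec_norm_nonneg [simp]: "0 \<le> vec_norm n x"
  by (simp add: vec_norm_def)

lemma vec_norm_zero [simp]: "vec_norm n (\<lambda>i. 0) = 0"
  by (simp add: vec_norm_def L2_set_0')

lemma vec_norm_sq: "(vec_norm n x)\<^sup>2 = (\<Sum>i<n. (norm (x i))\<^sup>2)"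
  by (simp add: vec_norm_def L2_set_def sum_nonneg)

lemma vec_norm_sq_vec_inner: "(vec_norm n x)\<^sup>2 = Re (vec_inner n x x)"
  by (simp add: vec_norm_sq vec_inner_def norm_sq_cinner)

lemma vec_norm_cong: "(\<And>i. i < n \<Longrightarrow> x i = y i) \<Longrightarrow> vec_norm n x = vec_norm n y"
  unfolding vec_norm_def by (rule L2_set_cong) auto

lemma vec_norm_add: "vec_norm n (\<lambda>i. x i + y i) \<le> vec_norm n x + vec_norm n y"
  unfolding vec_norm_def
  by (rule order_trans[OF L2_set_mono L2_set_triangle_ineq]) (auto simp: norm_triangle_ineq)

lemma vec_norm_scaleR: "vec_norm n (\<lambda>i. r *\<^sub>R x i) = \<bar>r\<bar> * vec_norm n x"
  by (simp add: vec_norm_def L2_set_right_distrib)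

lemma vec_norm_diff_sq:
  "(vec_norm n (\<lambda>i. x i - y i))\<^sup>2 = (vec_norm n x)\<^sup>2 - 2 * Re (vec_inner n x y) + (vec_norm n y)\<^sup>2"
  by (simp add: vec_norm_sq vec_inner_def norm_diff_sq sum.distrib sum_subtractf sum_distrib_left)

lemma norm_le_vec_norm: "i < n \<Longrightarrow> norm (x i) \<le> vec_norm n x"
  unfolding vec_norm_def by (rule member_le_L2_set) auto

lemma vec_norm_single: "j < n \<Longrightarrow> vec_norm n (\<lambda>i. if i = j then x else 0) = norm x"
  unfolding vec_norm_def L2_set_def
  by (simp add: if_distrib[of norm] if_distrib[of "\<lambda>t. t\<^sup>2"] cong: if_cong)

lemma Re_vec_inner_le: "Re (vec_inner n x y) \<le> vec_norm n x * vec_norm n y"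
proof -
  have "Re (vec_inner n x y) \<le> (\<Sum>i<n. \<bar>norm (x i)\<bar> * \<bar>norm (y i)\<bar>)"
    unfolding vec_inner_def Re_sum by (intro sum_mono) (simp add: Re_cinner_le)
  also have "\<dots> \<le> vec_norm n x * vec_norm n y"
    unfolding vec_norm_def by (rule L2_set_mult_ineq)
  finally show ?thesis .
qed

lemma matrices_overI: "(\<And>i j. i < n \<Longrightarrow> j < n \<Longrightarrow> M i j \<in> A) \<Longrightarrow> M \<in> matrices_over n A"
  and matrices_overD: "M \<in> matrices_over n A \<Longrightarrow> i < n \<Longrightarrow> j < n \<Longrightarrow> M i j \<in> A"
  by (simp_all add: matrices_over_def)

lemma op_matricesD: "M \<in> op_matrices n \<Longrightarrow> i < n \<Longrightarrow> j < n \<Longrightarrow> bdd_op (M i j)"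
  by (simp add: matrices_over_def)

lemma matrices_over_op_algebra:
  "op_algebra A \<Longrightarrow> M \<in> matrices_over n A \<Longrightarrow> M \<in> op_matrices n"
  by (simp add: matrices_over_def op_algebra_bdd)

lemma mat_mult_in_matrices_over:
  assumes "op_algebra A" "M \<in> matrices_over n A" "N \<in> matrices_over n A"
  shows "mat_mult n M N \<in> matrices_over n A"
  unfolding mat_mult_def
  by (intro matrices_overI op_algebra_sum op_algebra_comp)
     (use assms in \<open>auto dest: matrices_overD\<close>)

lemma mat_scale_in_matrices_over:
  "op_algebra A \<Longrightarrow> M \<in> matrices_over n A \<Longrightarrow> mat_scale r M \<in> matrices_over n A"
  by (simp add: matrices_over_def mat_scale_def op_algebra_scale)

lemma mat_adj_in_matrices_over:
  "(\<And>T. T \<in> A \<Longrightarrow> adj T \<in> A) \<Longrightarrow> M \<in> matrices_over n A \<Longrightarrow> mat_adj M \<in> matrices_over n A"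
  by (simp add: matrices_over_def mat_adj_def)

lemma mat_adj_in_op_matrices:
  fixes M :: "nat \<Rightarrow> nat \<Rightarrow> 'a::chilbert_space \<Rightarrow> 'a"
  shows "M \<in> op_matrices n \<Longrightarrow> mat_adj M \<in> op_matrices n"
  by (rule mat_adj_in_matrices_over) (auto simp: bdd_op_adj)

lemma mat_app_diff:
  "M \<in> op_matrices n \<Longrightarrow> i < n \<Longrightarrow>
    mat_app n M (\<lambda>j. x j - y j) i = mat_app n M x i - mat_app n M y i"
  by (simp add: mat_app_def linear_diff[OF bdd_op_linear[OF op_matricesD]] sum_subtractf)

lemma mat_app_scaleR:
  "M \<in> op_matrices n \<Longrightarrow> i < n \<Longrightarrow> mat_app n M (\<lambda>j. r *\<^sub>R x j) i = r *\<^sub>R mat_app n M x i"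
  by (simp add: mat_app_def linear_scale[OF bdd_op_linear[OF op_matricesD]] scaleR_sum_right)

lemma mat_app_single:
  assumes M: "M \<in> op_matrices n" and ij: "i < n" "j < n"
  shows "mat_app n M (\<lambda>k. if k = j then x else 0) i = M i j x"
proof -
  have "mat_app n M (\<lambda>k. if k = j then x else 0) i = (\<Sum>k<n. if k = j then M i k x else 0)"
    unfolding mat_app_def
    by (intro sum.cong) (auto simp: linear_0[OF bdd_op_linear[OF op_matricesD[OF M ij(1)]]])
  then show ?thesis using ij(2) by simp
qed

lemma mat_app_mat_mult:
  assumes M: "M \<in> op_matrices n" and i: "i < n"
  shows "mat_app n (mat_mult n M N) x i = mat_app n M (mat_app n N x) i"
proof -
  have "mat_app n (mat_mult n M N) x i = (\<Sum>l<n. \<Sum>j<n. M i l (N l j (x j)))"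
    unfolding mat_app_def mat_mult_def o_apply by (rule sum.swap)
  also have "\<dots> = mat_app n M (mat_app n N x) i"
    by (simp add: mat_app_def linear_sum[OF bdd_op_linear[OF op_matricesD[OF M i]]])
  finally show ?thesis .
qed

lemma mat_app_mat_scale: "mat_app n (mat_scale r M) x = (\<lambda>i. r *\<^sub>R mat_app n M x i)"
  by (simp add: fun_eq_iff mat_app_def mat_scale_def scaleC_of_real scaleR_sum_right)

lemma vec_inner_mat_adj:
  fixes M :: "nat \<Rightarrow> nat \<Rightarrow> 'a::chilbert_space \<Rightarrow> 'a"
  assumes M: "M \<in> op_matrices n"
  shows "vec_inner n x (mat_app n (mat_adj M) y) = vec_inner n (mat_app n M x) y"
proof -
  have "vec_inner n x (mat_app n (mat_adj M) y) = (\<Sum>i<n. \<Sum>j<n. cinner (M j i (x i)) (y j))"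
    unfolding vec_inner_def mat_app_def mat_adj_def cinner.sum_right
    by (intro sum.cong refl cinner_adj_right op_matricesD[OF M]) auto
  also have "\<dots> = vec_inner n (mat_app n M x) y"
    unfolding vec_inner_def mat_app_def cinner.sum_left by (rule sum.swap)
  finally show ?thesis .
qed

lemma mat_norm_eq_Sup: "mat_norm n M = Sup {vec_norm n (mat_app n M x) | x. vec_norm n x \<le> 1}"
  by (simp add: mat_norm_def vec_norm_def L2_set_def mat_app_def)

lemma mat_norm_le:
  assumes "0 \<le> K" "\<And>x. vec_norm n (mat_app n M x) \<le> K * vec_norm n x"
  shows "mat_norm n M \<le> K"
  unfolding mat_norm_eq_Sup
proof (rule cSup_least)
  show "{vec_norm n (mat_app n M x) |x. vec_norm n x \<le> 1} \<noteq> {}"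
    by (auto intro!: exI[of _ "\<lambda>i. 0"])
  fix r assume "r \<in> {vec_norm n (mat_app n M x) |x. vec_norm n x \<le> 1}"
  then obtain x where x: "r = vec_norm n (mat_app n M x)" "vec_norm n x \<le> 1" by blast
  show "r \<le> K" using assms(2)[of x] mult_left_mono[OF x(2) assms(1)] x(1) by simp
qed

lemma vec_norm_mat_app_le_sum_onorm:
  assumes M: "M \<in> op_matrices n"
  shows "vec_norm n (mat_app n M x) \<le> (\<Sum>i<n. \<Sum>j<n. onorm (M i j)) * vec_norm n x"
proof -
  have "vec_norm n (mat_app n M x) \<le> (\<Sum>i<n. norm (mat_app n M x i))"
    unfolding vec_norm_def by (rule L2_set_le_sum) auto
  also have "\<dots> \<le> (\<Sum>i<n. \<Sum>j<n. onorm (M i j) * vec_norm n x)"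
    unfolding mat_app_def
  proof (intro sum_mono order_trans[OF norm_sum])
    fix i j assume "i \<in> {..<n}" "j \<in> {..<n}"
    then have ij: "i < n" "j < n" by auto
    have "norm (M i j (x j)) \<le> onorm (M i j) * norm (x j)"
      by (rule bdd_op_norm_le[OF op_matricesD[OF M ij]])
    also have "\<dots> \<le> onorm (M i j) * vec_norm n x"
      by (intro mult_left_mono norm_le_vec_norm ij onorm_pos_le bdd_op_bounded_linear
          op_matricesD[OF M])
    finally show "norm (M i j (x j)) \<le> onorm (M i j) * vec_norm n x" .
  qed
  finally show ?thesis by (simp add: sum_distrib_right)
qed

lemma vec_norm_mat_app_le_mat_norm:
  assumes M: "M \<in> op_matrices n" and x: "vec_norm n x \<le> 1"
  shows "vec_norm n (mat_app n M x) \<le> mat_norm n M"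
  unfolding mat_norm_eq_Sup
proof (rule cSup_upper)
  let ?K = "\<Sum>i<n. \<Sum>j<n. onorm (M i j)"
  have K: "0 \<le> ?K"
    by (intro sum_nonneg) (auto intro: onorm_pos_le bdd_op_bounded_linear op_matricesD[OF M])
  have "vec_norm n (mat_app n M y) \<le> ?K" if "vec_norm n y \<le> 1" for y
    using vec_norm_mat_app_le_sum_onorm[OF M, of y] mult_left_mono[OF that K] by simp
  then show "bdd_above {vec_norm n (mat_app n M x) |x. vec_norm n x \<le> 1}"
    by (intro bdd_aboveI[of _ ?K]) auto
qed (use x in blast)

lemma mat_norm_nonneg: "M \<in> op_matrices n \<Longrightarrow> 0 \<le> mat_norm n M"
  by (rule order_trans[OF vec_norm_nonneg vec_norm_mat_app_le_mat_norm[of M n "\<lambda>i. 0"]]) simp_all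

lemma vec_norm_mat_app_le:
  assumes M: "M \<in> op_matrices n"
  shows "vec_norm n (mat_app n M x) \<le> mat_norm n M * vec_norm n x"
proof (cases "vec_norm n x = 0")
  case True
  then show ?thesis using vec_norm_mat_app_le_sum_onorm[OF M, of x] by simp
next
  case False
  let ?r = "1 / vec_norm n x"
  have pos: "0 < vec_norm n x" using False by (simp add: less_le)
  have "?r * vec_norm n (mat_app n M x) = vec_norm n (\<lambda>i. ?r *\<^sub>R mat_app n M x i)"
    by (simp add: vec_norm_scaleR)
  also have "\<dots> = vec_norm n (mat_app n M (\<lambda>i. ?r *\<^sub>R x i))"
    by (rule vec_norm_cong) (simp add: mat_app_scaleR[OF M])
  also have "\<dots> \<le> mat_norm n M"
    using False by (intro vec_norm_mat_app_le_mat_norm M) (simp add: vec_norm_scaleR)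
  finally show ?thesis using pos by (simp add: divide_simps)
qed

lemma onorm_entry_le_mat_norm:
  fixes M :: "nat \<Rightarrow> nat \<Rightarrow> 'a::complex_inner \<Rightarrow> 'a"
  assumes M: "M \<in> op_matrices n" and ij: "i < n" "j < n"
  shows "onorm (M i j) \<le> mat_norm n M"
proof (rule onorm_bound[OF mat_norm_nonneg[OF M]])
  fix x :: 'a
  let ?e = "\<lambda>k::nat. if k = j then x else 0"
  have "norm (M i j x) \<le> vec_norm n (mat_app n M ?e)"
    using norm_le_vec_norm[OF ij(1), of "mat_app n M ?e"] by (simp add: mat_app_single[OF M ij])
  also have "\<dots> \<le> mat_norm n M * vec_norm n ?e" by (rule vec_norm_mat_app_le[OF M])
  finally show "norm (M i j x) \<le> mat_norm n M * norm x" using ij(2) by (simp add: vec_norm_single)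
qed

lemma mat_norm_mult_le:
  assumes M: "M \<in> op_matrices n" and N: "N \<in> op_matrices n"
  shows "mat_norm n (mat_mult n M N) \<le> mat_norm n M * mat_norm n N"
proof (rule mat_norm_le)
  show "0 \<le> mat_norm n M * mat_norm n N" by (simp add: mat_norm_nonneg M N)
  fix x
  have "vec_norm n (mat_app n (mat_mult n M N) x) = vec_norm n (mat_app n M (mat_app n N x))"
    by (rule vec_norm_cong) (rule mat_app_mat_mult[OF M])
  also have "\<dots> \<le> mat_norm n M * vec_norm n (mat_app n N x)"
    by (rule vec_norm_mat_app_le[OF M])
  also have "\<dots> \<le> mat_norm n M * (mat_norm n N * vec_norm n x)"
    by (intro mult_left_mono vec_norm_mat_app_le N mat_norm_nonneg M)
  finally show "vec_norm n (mat_app n (mat_mult n M N) x)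
      \<le> mat_norm n M * mat_norm n N * vec_norm n x"
    by (simp add: mult.assoc)
qed

lemma mat_norm_scale_le:
  assumes M: "M \<in> op_matrices n"
  shows "mat_norm n (mat_scale r M) \<le> \<bar>r\<bar> * mat_norm n M"
  using mult_left_mono[OF vec_norm_mat_app_le[OF M], of "\<bar>r\<bar>"]
  by (intro mat_norm_le)
     (simp_all add: mat_app_mat_scale vec_norm_scaleR mat_norm_nonneg[OF M] mult.assoc)

lemma mat_norm_adj_le:
  fixes M :: "nat \<Rightarrow> nat \<Rightarrow> 'a::chilbert_space \<Rightarrow> 'a"
  assumes M: "M \<in> op_matrices n"
  shows "mat_norm n (mat_adj M) \<le> mat_norm n M"
proof (rule mat_norm_le[OF mat_norm_nonneg[OF M]])
  fix x
  let ?y = "mat_app n (mat_adj M) x"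
  have "(vec_norm n ?y)\<^sup>2 = Re (vec_inner n (mat_app n M ?y) x)"
    by (simp add: vec_norm_sq_vec_inner vec_inner_mat_adj[OF M])
  also have "\<dots> \<le> vec_norm n (mat_app n M ?y) * vec_norm n x" by (rule Re_vec_inner_le)
  also have "\<dots> \<le> (mat_norm n M * vec_norm n ?y) * vec_norm n x"
    by (intro mult_right_mono vec_norm_mat_app_le M) simp
  finally have "vec_norm n ?y * vec_norm n ?y \<le> (mat_norm n M * vec_norm n x) * vec_norm n ?y"
    by (simp add: power2_eq_square mult_ac)
  then show "vec_norm n ?y \<le> mat_norm n M * vec_norm n x"
    using mat_norm_nonneg[OF M] by (cases "vec_norm n ?y = 0") (auto simp: less_le)
qed

section \<open>The resolvent of an operator matrix\<close>

lemma closed_op_algebra_mat_suminf: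
  fixes C :: "('a::chilbert_space \<Rightarrow> 'a) set"
  assumes C: "closed_op_algebra C" and P: "\<And>k. P k \<in> matrices_over n C"
    and summable: "summable (\<lambda>k. mat_norm n (P k))"
  obtains B where "B \<in> matrices_over n C"
    "\<And>i j x. i < n \<Longrightarrow> j < n \<Longrightarrow> (\<lambda>k. P k i j x) sums B i j x"
proof -
  note alg = closed_op_algebra_op_algebra[OF C]
  have "\<exists>L\<in>C. \<forall>x. (\<lambda>k. P k i j x) sums L x" if ij: "i < n" "j < n" for i j
  proof -
    have P_ij: "P k i j \<in> C" for k by (rule matrices_overD[OF P ij])
    have "norm (onorm (P k i j)) \<le> mat_norm n (P k)" for k
      using onorm_entry_le_mat_norm[OF matrices_over_op_algebra[OF alg P] ij, of k]
        onorm_pos_le[OF bdd_op_bounded_linear[OF op_algebra_bdd[OF alg P_ij]], of k] by simp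
    then have "summable (\<lambda>k. onorm (P k i j))"
      by (rule summable_comparison_test'[OF summable, of 0])
    then show ?thesis
      using closed_op_algebra_suminf[where T = "\<lambda>k. P k i j", OF C P_ij] by blast
  qed
  then have "\<forall>i j. \<exists>L. i < n \<longrightarrow> j < n \<longrightarrow> L \<in> C \<and> (\<forall>x. (\<lambda>k. P k i j x) sums L x)"
    by blast
  then obtain B where
    "\<forall>i j. i < n \<longrightarrow> j < n \<longrightarrow> B i j \<in> C \<and> (\<forall>x. (\<lambda>k. P k i j x) sums B i j x)"
    unfolding choice_iff by blast
  then show thesis by (intro that[of B]) (auto intro: matrices_overI)
qed

text \<open>\<open>B\<close> is the sum of the powers \<open>A\<^sup>k\<close> with \<open>k \<ge> 1\<close>, so \<open>1 + B\<close> is the inverse of \<open>1 - A\<close>.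
  Leaving out the identity keeps the entries of \<open>B\<close> inside a possibly nonunital algebra.\<close>

lemma neumann_series:
  fixes C :: "('a::chilbert_space \<Rightarrow> 'a) set"
  assumes C: "closed_op_algebra C" and A: "A \<in> matrices_over n C" and less: "mat_norm n A < 1"
  obtains B where "B \<in> matrices_over n C"
    "\<And>i j. i < n \<Longrightarrow> j < n \<Longrightarrow> B i j = op_add (A i j) (mat_mult n B A i j)"
proof -
  note alg = closed_op_algebra_op_algebra[OF C]
  note bdd = matrices_over_op_algebra[OF alg]
  define s where "s = mat_norm n A"
  have s: "0 \<le> s" "s < 1"
    unfolding s_def by (rule mat_norm_nonneg[OF bdd[OF A]]) (rule less)
  define P where "P k = ((\<lambda>N. mat_mult n N A) ^^ k) A" for k
  have P_0: "P 0 = A" and P_Suc: "P (Suc k) = mat_mult n (P k) A" for k by (simp_all add: P_def)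
  have P: "P k \<in> matrices_over n C" for k
    by (induction k) (simp_all add: P_0 P_Suc A mat_mult_in_matrices_over[OF alg])
  have norm_P: "mat_norm n (P k) \<le> s * s ^ k" for k
  proof (induction k)
    case (Suc k)
    have "mat_norm n (P (Suc k)) \<le> mat_norm n (P k) * s"
      unfolding P_Suc s_def by (intro mat_norm_mult_le bdd P A)
    also have "\<dots> \<le> (s * s ^ k) * s" using s Suc by (intro mult_right_mono)
    finally show ?case by (simp add: mult_ac)
  qed (simp add: P_0 s_def)
  have "summable (\<lambda>k. s * s ^ k)" using s by (intro summable_mult summable_geometric) simp
  then have "summable (\<lambda>k. mat_norm n (P k))"
    by (rule summable_comparison_test'[of _ 0]) (simp add: mat_norm_nonneg bdd P norm_P)
  then obtain B where B: "B \<in> matrices_over n C"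
    and sums: "\<And>i j x. i < n \<Longrightarrow> j < n \<Longrightarrow> (\<lambda>k. P k i j x) sums B i j x"
    using closed_op_algebra_mat_suminf[of C P n, OF C P] by blast
  have "B i j x = A i j x + mat_mult n B A i j x" if ij: "i < n" "j < n" for i j x
  proof -
    have "(\<lambda>k. P (Suc k) i j x) sums mat_mult n B A i j x"
      unfolding P_Suc mat_mult_def o_apply by (intro sums_sum sums ij) auto
    then have "(\<lambda>k. P k i j x) sums (mat_mult n B A i j x + A i j x)"
      by (simp add: sums_Suc_iff[of "\<lambda>k. P k i j x"] P_0)
    then show ?thesis using sums_unique2[OF sums[OF ij]] by (simp add: add.commute)
  qed
  then show thesis by (intro that[OF B]) (simp add: fun_eq_iff)
qed

lemma vec_norm_le_resolvent:
  assumes A: "A \<in> op_matrices n" and B: "B \<in> op_matrices n"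
    and eq: "\<And>i j. i < n \<Longrightarrow> j < n \<Longrightarrow> B i j = op_add (A i j) (mat_mult n B A i j)"
  shows "vec_norm n x \<le> (1 + mat_norm n B) * vec_norm n (\<lambda>i. x i - mat_app n A x i)"
proof -
  let ?y = "\<lambda>i. x i - mat_app n A x i"
  have "x i = ?y i + mat_app n B ?y i" if i: "i < n" for i
  proof -
    have "mat_app n B x i = (\<Sum>j<n. A i j (x j) + mat_mult n B A i j (x j))"
      unfolding mat_app_def using i by (intro sum.cong refl) (simp add: eq)
    also have "\<dots> = mat_app n A x i + mat_app n B (mat_app n A x) i"
      by (simp add: sum.distrib mat_app_mat_mult[OF B i, symmetric]) (simp add: mat_app_def)
    finally show ?thesis by (simp add: mat_app_diff[OF B i])
  qed
  then have "vec_norm n x = vec_norm n (\<lambda>i. ?y i + mat_app n B ?y i)"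
    by (rule vec_norm_cong)
  also have "\<dots> \<le> vec_norm n ?y + mat_norm n B * vec_norm n ?y"
    by (intro order_trans[OF vec_norm_add] add_left_mono vec_norm_mat_app_le B)
  finally show ?thesis by (simp add: distrib_right)
qed

definition normalized_gram ::
  "nat \<Rightarrow> (nat \<Rightarrow> nat \<Rightarrow> 'a \<Rightarrow> 'a) \<Rightarrow> nat \<Rightarrow> nat \<Rightarrow> 'a \<Rightarrow> 'a::complex_inner" where
  "normalized_gram n T = mat_scale (1 / (mat_norm n T)\<^sup>2) (mat_mult n (mat_adj T) T)"

lemma vec_norm_diff_normalized_gram_sq_le:
  fixes T :: "nat \<Rightarrow> nat \<Rightarrow> 'a::chilbert_space \<Rightarrow> 'a"
  assumes T: "T \<in> op_matrices n"
  shows "(vec_norm n (\<lambda>i. x i - mat_app n (normalized_gram n T) x i))\<^sup>2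
    \<le> (vec_norm n x)\<^sup>2 - (vec_norm n (mat_app n T x))\<^sup>2 / (mat_norm n T)\<^sup>2"
proof -
  define r where "r = mat_norm n T"
  define y where "y = mat_app n T x"
  define z where "z = mat_app n (mat_adj T) y"
  note Tadj = mat_adj_in_op_matrices[OF T]
  have gram: "mat_app n (normalized_gram n T) x i = (1 / r\<^sup>2) *\<^sub>R z i" if "i < n" for i
    using that
    by (simp add: normalized_gram_def mat_app_mat_scale mat_app_mat_mult[OF Tadj] z_def y_def r_def)
  have "Re (vec_inner n x (\<lambda>i. (1 / r\<^sup>2) *\<^sub>R z i)) = Re (vec_inner n x z) / r\<^sup>2"
    by (simp add: vec_inner_def cinner.scaleR_right sum_divide_distrib)
  also have "\<dots> = (vec_norm n y)\<^sup>2 / r\<^sup>2"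
    by (simp add: z_def vec_inner_mat_adj[OF T] vec_norm_sq_vec_inner y_def)
  finally have inner: "Re (vec_inner n x (\<lambda>i. (1 / r\<^sup>2) *\<^sub>R z i)) = (vec_norm n y)\<^sup>2 / r\<^sup>2" .
  have "vec_norm n z \<le> mat_norm n (mat_adj T) * vec_norm n y"
    unfolding z_def by (rule vec_norm_mat_app_le[OF Tadj])
  also have "\<dots> \<le> r * vec_norm n y"
    unfolding r_def by (intro mult_right_mono mat_norm_adj_le T) simp
  finally have "(vec_norm n z)\<^sup>2 \<le> r\<^sup>2 * (vec_norm n y)\<^sup>2"
    unfolding power_mult_distrib[symmetric] by (rule power_mono) simp
  from divide_right_mono[OF this, of "(r\<^sup>2)\<^sup>2"]
  have norm_z: "(vec_norm n z)\<^sup>2 / (r\<^sup>2)\<^sup>2 \<le> (vec_norm n y)\<^sup>2 / r\<^sup>2"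
    by (cases "r = 0") (simp_all add: power2_eq_square)
  have "(vec_norm n (\<lambda>i. x i - mat_app n (normalized_gram n T) x i))\<^sup>2
      = (vec_norm n (\<lambda>i. x i - (1 / r\<^sup>2) *\<^sub>R z i))\<^sup>2"
    by (intro arg_cong[where f = "\<lambda>t. t\<^sup>2"] vec_norm_cong) (simp add: gram)
  also have "\<dots> = (vec_norm n x)\<^sup>2 - 2 * ((vec_norm n y)\<^sup>2 / r\<^sup>2) + (vec_norm n z)\<^sup>2 / (r\<^sup>2)\<^sup>2"
    unfolding vec_norm_diff_sq inner vec_norm_scaleR by (simp add: power_divide power_mult_distrib)
  also have "\<dots> \<le> (vec_norm n x)\<^sup>2 - (vec_norm n y)\<^sup>2 / r\<^sup>2" using norm_z by simp
  finally show ?thesis by (simp only: y_def r_def)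
qed

lemma mat_norm_sq_approx_eigenvalue:
  fixes T :: "nat \<Rightarrow> nat \<Rightarrow> 'a::chilbert_space \<Rightarrow> 'a"
  assumes T: "T \<in> op_matrices n" and pos: "0 < mat_norm n T" and K: "1 \<le> K"
  shows "\<exists>x. K * vec_norm n (\<lambda>i. x i - mat_app n (normalized_gram n T) x i) < vec_norm n x"
proof (rule ccontr)
  define r where "r = mat_norm n T"
  define c where "c = r * sqrt (1 - 1 / K\<^sup>2)"
  have r: "0 < r" using pos by (simp add: r_def)
  have K_sq: "1 / K\<^sup>2 \<le> 1" "0 < 1 / K\<^sup>2" using K by (simp_all add: divide_le_eq)
  assume "\<not> ?thesis"
  then have bound: "vec_norm n x \<le> K * vec_norm n (\<lambda>i. x i - mat_app n (normalized_gram n T) x i)"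
    for x by (meson not_less)
  have "vec_norm n (mat_app n T x) \<le> c * vec_norm n x" for x
  proof (rule power2_le_imp_le)
    have "(vec_norm n x)\<^sup>2 \<le> K\<^sup>2 * (vec_norm n (\<lambda>i. x i - mat_app n (normalized_gram n T) x i))\<^sup>2"
      using power_mono[OF bound vec_norm_nonneg, of x 2] by (simp add: power_mult_distrib)
    also have "\<dots> \<le> K\<^sup>2 * ((vec_norm n x)\<^sup>2 - (vec_norm n (mat_app n T x))\<^sup>2 / r\<^sup>2)"
      unfolding r_def by (intro mult_left_mono vec_norm_diff_normalized_gram_sq_le T) simp
    finally have "(vec_norm n (mat_app n T x))\<^sup>2 \<le> r\<^sup>2 * (1 - 1 / K\<^sup>2) * (vec_norm n x)\<^sup>2"
      using r K by (simp add: field_simps)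
    also have "r\<^sup>2 * (1 - 1 / K\<^sup>2) = c\<^sup>2"
      using K_sq by (simp add: c_def power_mult_distrib)
    finally show "(vec_norm n (mat_app n T x))\<^sup>2 \<le> (c * vec_norm n x)\<^sup>2"
      by (simp add: power_mult_distrib)
  qed (use r K_sq in \<open>simp add: c_def\<close>)
  then have "r \<le> c"
    unfolding r_def by (rule mat_norm_le[rotated]) (use r K_sq in \<open>simp add: c_def\<close>)
  also have "c < r * 1"
    unfolding c_def using r K_sq by (intro mult_strict_left_mono) auto
  finally show False by simp
qed

section \<open>Complete contractivity of *-representations\<close>

lemma cstar_subalgD:
  assumes "cstar_subalg C"
  shows cstar_subalg_closed: "closed_op_algebra C"
    and cstar_subalg_op_algebra: "op_algebra C"
    and cstar_subalg_adj: "T \<in> C \<Longrightarrow> adj T \<in> C"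
    and cstar_subalg_bdd: "T \<in> C \<Longrightarrow> bdd_op T"
  using assms by (auto simp: cstar_subalg_def closed_op_algebra_def op_algebra_bdd)

locale star_representation =
  fixes C :: "('a::chilbert_space \<Rightarrow> 'a) set" and \<theta> :: "('a \<Rightarrow> 'a) \<Rightarrow> 'b::chilbert_space \<Rightarrow> 'b"
  assumes C_cstar: "cstar_subalg C" and hom_star_rep: "star_rep C \<theta>"
begin

lemmas C_closed = cstar_subalg_closed[OF C_cstar]
  and C_op_algebra = cstar_subalg_op_algebra[OF C_cstar]
  and C_adj = cstar_subalg_adj[OF C_cstar]

lemma hom_add: "S \<in> C \<Longrightarrow> T \<in> C \<Longrightarrow> \<theta> (op_add S T) = op_add (\<theta> S) (\<theta> T)"
  and hom_comp: "S \<in> C \<Longrightarrow> T \<in> C \<Longrightarrow> \<theta> (S \<circ> T) = \<theta> S \<circ> \<theta> T"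
  and hom_scale: "T \<in> C \<Longrightarrow> \<theta> (op_scale c T) = op_scale c (\<theta> T)"
  and hom_adj: "T \<in> C \<Longrightarrow> \<theta> (adj T) = adj (\<theta> T)"
  and hom_bdd: "T \<in> C \<Longrightarrow> bdd_op (\<theta> T)"
  using hom_star_rep by (simp_all add: star_rep_def alg_hom_def)

lemma hom_zero: "\<theta> (\<lambda>x. 0) = (\<lambda>x. 0)"
  using hom_scale[OF op_algebra_zero[OF C_op_algebra], of 0] by (simp add: op_scale_def)

lemma hom_diff: "S \<in> C \<Longrightarrow> T \<in> C \<Longrightarrow> \<theta> (S - T) = \<theta> S - \<theta> T"
  by (simp add: diff_eq_op_add hom_add hom_scale op_algebra_scale[OF C_op_algebra])

lemma hom_sum:
  assumes "finite I" "\<And>i. i \<in> I \<Longrightarrow> T i \<in> C"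
  shows "\<theta> (\<lambda>x. \<Sum>i\<in>I. T i x) = (\<lambda>x. \<Sum>i\<in>I. \<theta> (T i) x)"
  using assms
proof (induction I)
  case (insert i I)
  have "\<theta> (op_add (T i) (\<lambda>x. \<Sum>i\<in>I. T i x)) = op_add (\<theta> (T i)) (\<theta> (\<lambda>x. \<Sum>i\<in>I. T i x))"
    using insert.prems insert.hyps(1) by (intro hom_add op_algebra_sum[OF C_op_algebra]) auto
  then show ?case using insert by (simp add: op_add_def)
qed (simp add: hom_zero)

abbreviation amplify :: "(nat \<Rightarrow> nat \<Rightarrow> 'a \<Rightarrow> 'a) \<Rightarrow> nat \<Rightarrow> nat \<Rightarrow> 'b \<Rightarrow> 'b" where
  "amplify M \<equiv> (\<lambda>i j. \<theta> (M i j))"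

lemma amplify_in_op_matrices: "M \<in> matrices_over n C \<Longrightarrow> amplify M \<in> op_matrices n"
  by (simp add: matrices_over_def hom_bdd)

lemma hom_mat_mult:
  assumes "M \<in> matrices_over n C" "N \<in> matrices_over n C" "i < n" "j < n"
  shows "\<theta> (mat_mult n M N i j) = mat_mult n (amplify M) (amplify N) i j"
proof -
  have entries: "M i l \<in> C" "N l j \<in> C" if "l < n" for l
    using assms that by (auto simp: matrices_over_def)
  have "\<theta> (mat_mult n M N i j) = (\<lambda>x. \<Sum>l<n. \<theta> (M i l \<circ> N l j) x)"
    unfolding mat_mult_def using entries by (intro hom_sum op_algebra_comp[OF C_op_algebra]) auto
  also have "\<dots> = mat_mult n (amplify M) (amplify N) i j"
    unfolding mat_mult_def by (intro ext sum.cong refl) (simp add: hom_comp entries)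
  finally show ?thesis .
qed

lemma hom_gram:
  assumes M: "M \<in> matrices_over n C" and "i < n" "j < n"
  shows "\<theta> (mat_mult n (mat_adj M) M i j) = mat_mult n (mat_adj (amplify M)) (amplify M) i j"
proof -
  have "\<theta> (mat_adj M i l) = mat_adj (amplify M) i l" if "l < n" for l
    using matrices_overD[OF M that assms(2)] by (simp add: mat_adj_def hom_adj)
  moreover have "mat_adj M \<in> matrices_over n C"
    by (rule mat_adj_in_matrices_over[OF C_adj M])
  ultimately show ?thesis
    using hom_mat_mult assms by (simp add: mat_mult_def)
qed

lemma vec_norm_le_amplify_resolvent:
  assumes A: "A \<in> matrices_over n C" and less: "mat_norm n A < 1"
  obtains K where "1 \<le> K"
    "\<And>x. vec_norm n x \<le> K * vec_norm n (\<lambda>i. x i - mat_app n (amplify A) x i)"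
proof -
  obtain B where B: "B \<in> matrices_over n C"
    and eq: "\<And>i j. i < n \<Longrightarrow> j < n \<Longrightarrow> B i j = op_add (A i j) (mat_mult n B A i j)"
    using neumann_series[OF C_closed A less] by blast
  have hom_B: "\<theta> (B i j) = op_add (\<theta> (A i j)) (mat_mult n (amplify B) (amplify A) i j)"
    if ij: "i < n" "j < n" for i j
  proof -
    have "mat_mult n B A i j \<in> C"
      using mat_mult_in_matrices_over[OF C_op_algebra B A] ij by (rule matrices_overD)
    then show ?thesis
      by (simp add: eq[OF ij] hom_add matrices_overD[OF A ij] hom_mat_mult[OF B A ij])
  qed
  show thesis
  proof (rule that)
    show "1 \<le> 1 + mat_norm n (amplify B)"
      by (simp add: mat_norm_nonneg amplify_in_op_matrices[OF B])
    show "vec_norm n x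
        \<le> (1 + mat_norm n (amplify B)) * vec_norm n (\<lambda>i. x i - mat_app n (amplify A) x i)" for x
      by (intro vec_norm_le_resolvent amplify_in_op_matrices A B hom_B)
  qed
qed

text \<open>If \<open>r = \<parallel>\<theta>(M)\<parallel>\<close> exceeded \<open>\<parallel>M\<parallel>\<close>, then \<open>1 - \<theta>(M)\<^sup>* \<theta>(M) / r\<^sup>2\<close> would be bounded below, although \<open>r\<^sup>2\<close> is
  an approximate eigenvalue of \<open>\<theta>(M)\<^sup>* \<theta>(M)\<close>.\<close>

theorem mat_norm_amplify_le:
  assumes M: "M \<in> matrices_over n C"
  shows "mat_norm n (amplify M) \<le> mat_norm n M"
proof (rule ccontr)
  define r where "r = mat_norm n (amplify M)"
  let ?G = "mat_mult n (mat_adj M) M"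
  have M_bdd: "M \<in> op_matrices n" by (rule matrices_over_op_algebra[OF C_op_algebra M])
  have G: "?G \<in> matrices_over n C"
    by (intro mat_mult_in_matrices_over C_op_algebra mat_adj_in_matrices_over C_adj M)
  assume "\<not> mat_norm n (amplify M) \<le> mat_norm n M"
  then have r: "mat_norm n M < r" "0 < r" using mat_norm_nonneg[OF M_bdd] by (auto simp: r_def)
  have "mat_norm n ?G \<le> mat_norm n (mat_adj M) * mat_norm n M"
    by (intro mat_norm_mult_le mat_adj_in_op_matrices M_bdd)
  also have "\<dots> \<le> mat_norm n M * mat_norm n M"
    by (intro mult_right_mono mat_norm_adj_le mat_norm_nonneg M_bdd)
  also have "\<dots> < r * r" by (intro mult_strict_mono' r mat_norm_nonneg M_bdd)
  finally have "1 / r\<^sup>2 * mat_norm n ?G < 1" using r by (simp add: power2_eq_square)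
  then have "mat_norm n (mat_scale (1 / r\<^sup>2) ?G) < 1"
    using mat_norm_scale_le[OF matrices_over_op_algebra[OF C_op_algebra G], of "1 / r\<^sup>2"] by simp
  with mat_scale_in_matrices_over[OF C_op_algebra G] obtain K where K: "1 \<le> K"
    and bounded_below: "\<And>x. vec_norm n x
      \<le> K * vec_norm n (\<lambda>i. x i - mat_app n (amplify (mat_scale (1 / r\<^sup>2) ?G)) x i)"
    by (rule vec_norm_le_amplify_resolvent) blast
  have "\<theta> (mat_scale (1 / r\<^sup>2) ?G i j) = normalized_gram n (amplify M) i j"
    if ij: "i < n" "j < n" for i j
    using matrices_overD[OF G ij] hom_gram[OF M ij]
    by (simp add: normalized_gram_def mat_scale_def hom_scale r_def del: of_real_divide)
  then have "vec_norm n x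
      \<le> K * vec_norm n (\<lambda>i. x i - mat_app n (normalized_gram n (amplify M)) x i)" for x
    using bounded_below[of x] by (simp add: mat_app_def cong: vec_norm_cong)
  then show False
    using mat_norm_sq_approx_eigenvalue[OF amplify_in_op_matrices[OF M] _ K] r(2)
    unfolding r_def by (meson not_less)
qed

corollary onorm_hom_le:
  assumes T: "T \<in> C"
  shows "onorm (\<theta> T) \<le> onorm T"
proof -
  let ?M = "\<lambda>(i::nat) (j::nat). T"
  have M: "?M \<in> matrices_over 1 C" using T by (simp add: matrices_over_def)
  have vec_norm_1: "vec_norm (Suc 0) y = norm (y 0)" for y :: "nat \<Rightarrow> 'a"
    by (simp add: vec_norm_def lessThan_Suc)
  have bdd: "bdd_op T" by (rule cstar_subalg_bdd[OF C_cstar T])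
  have "onorm (\<theta> T) \<le> mat_norm 1 (amplify ?M)"
    using onorm_entry_le_mat_norm[OF amplify_in_op_matrices[OF M], of 0 0] by simp
  also have "\<dots> \<le> mat_norm 1 ?M" by (rule mat_norm_amplify_le[OF M])
  also have "\<dots> \<le> onorm T"
    using bdd_op_norm_le[OF bdd]
    by (intro mat_norm_le onorm_pos_le bdd_op_bounded_linear[OF bdd])
       (simp add: vec_norm_1 mat_app_def)
  finally show ?thesis .
qed

lemma onorm_hom_diff_le: "S \<in> C \<Longrightarrow> T \<in> C \<Longrightarrow> onorm (\<theta> S - \<theta> T) \<le> onorm (S - T)"
  using onorm_hom_le[OF op_algebra_diff[OF C_op_algebra]] by (simp add: hom_diff)

end

section \<open>Generated C*-algebras\<close>

lemma cstar_gen_superset: "S \<subseteq> cstar_gen S"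
  by (auto simp: cstar_gen_def)

lemma cstar_gen_least: "cstar_subalg B \<Longrightarrow> S \<subseteq> B \<Longrightarrow> cstar_gen S \<subseteq> B"
  by (auto simp: cstar_gen_def)

lemma cstar_gen_mono: "S \<subseteq> S' \<Longrightarrow> cstar_gen S \<subseteq> cstar_gen S'"
  by (auto simp: cstar_gen_def)

lemma cstar_subalgI: "closed_op_algebra B \<Longrightarrow> (\<And>T. T \<in> B \<Longrightarrow> adj T \<in> B) \<Longrightarrow> cstar_subalg B"
  by (simp add: cstar_subalg_def closed_op_algebra_def)

lemma cstar_subalg_selfadjoint_part:
  fixes A :: "('a::chilbert_space \<Rightarrow> 'a) set"
  assumes A: "closed_op_algebra A"
  shows "cstar_subalg {T \<in> A. adj T \<in> A}"
proof (rule cstar_subalgI)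
  note alg = closed_op_algebra_op_algebra[OF A]
  note bdd = op_algebra_bdd[OF alg]
  show "closed_op_algebra {T \<in> A. adj T \<in> A}"
  proof (rule closed_op_algebraI)
    fix T assume T: "bdd_op T" and appr: "\<And>e. e > 0 \<Longrightarrow> \<exists>S\<in>{T \<in> A. adj T \<in> A}. onorm (T - S) < e"
    have "T \<in> A" by (rule closed_op_algebra_limit[OF A T]) (use appr in blast)
    moreover have "adj T \<in> A"
    proof (rule closed_op_algebra_limit[OF A bdd_op_adj[OF T]])
      fix e :: real assume "e > 0"
      then obtain S where S: "S \<in> A" "adj S \<in> A" "onorm (T - S) < e" using appr by blast
      have "onorm (adj T - adj S) \<le> onorm (T - S)"
        using onorm_adj_le[OF bdd_op_diff[OF T bdd[OF S(1)]]] by (simp add: adj_diff T bdd S(1))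
      with S show "\<exists>S\<in>A. onorm (adj T - S) < e" by (meson le_less_trans)
    qed
    ultimately show "T \<in> {T \<in> A. adj T \<in> A}" by simp
  qed (auto simp: bdd adj_zero adj_op_add adj_comp adj_op_scale op_algebra_zero[OF alg]
      op_algebra_add[OF alg] op_algebra_comp[OF alg] op_algebra_scale[OF alg])
qed (auto simp: adj_adj op_algebra_bdd[OF closed_op_algebra_op_algebra[OF A]])

lemma cstar_gen_subset_closed_op_algebra:
  fixes A :: "('a::chilbert_space \<Rightarrow> 'a) set"
  assumes "closed_op_algebra A" "\<And>T. T \<in> S \<Longrightarrow> T \<in> A \<and> adj T \<in> A"
  shows "cstar_gen S \<subseteq> A"
  using cstar_gen_least[OF cstar_subalg_selfadjoint_part[OF assms(1)], of S] assms(2) by blast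

lemma cstar_subalg_cstar_gen:
  fixes S :: "('a::chilbert_space \<Rightarrow> 'a) set"
  assumes S: "S \<subseteq> Collect bdd_op"
  shows "cstar_subalg (cstar_gen S)"
proof (rule cstar_subalgI)
  have bdd: "cstar_gen S \<subseteq> Collect bdd_op"
    by (rule cstar_gen_subset_closed_op_algebra[OF closed_op_algebra_bdd_ops])
       (use S in \<open>auto simp: bdd_op_adj\<close>)
  show "closed_op_algebra (cstar_gen S)"
  proof (rule closed_op_algebraI)
    fix T assume T: "bdd_op T" and appr: "\<And>e. e > 0 \<Longrightarrow> \<exists>R\<in>cstar_gen S. onorm (T - R) < e"
    have "T \<in> B" if B: "cstar_subalg B" "S \<subseteq> B" for B
      using closed_op_algebra_limit[OF cstar_subalg_closed[OF B(1)] T] appr cstar_gen_least[OF B]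
      by (meson subsetD)
    then show "T \<in> cstar_gen S" by (simp add: cstar_gen_def)
  qed (use bdd in \<open>auto simp: cstar_gen_def op_algebra_zero op_algebra_add op_algebra_comp
      op_algebra_scale cstar_subalg_op_algebra\<close>)
qed (simp add: cstar_gen_def cstar_subalg_adj)

context star_representation
begin

lemma closed_op_algebra_preimage:
  assumes D: "closed_op_algebra D"
  shows "closed_op_algebra {T \<in> C. \<theta> T \<in> D}"
proof (rule closed_op_algebraI)
  fix T assume T: "bdd_op T" and appr: "\<And>e. e > 0 \<Longrightarrow> \<exists>S\<in>{T \<in> C. \<theta> T \<in> D}. onorm (T - S) < e"
  have TC: "T \<in> C" by (rule closed_op_algebra_limit[OF C_closed T]) (use appr in blast)
  have "\<theta> T \<in> D"
  proof (rule closed_op_algebra_limit[OF D hom_bdd[OF TC]])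
    fix e :: real assume "e > 0"
    then obtain S where S: "S \<in> C" "\<theta> S \<in> D" "onorm (T - S) < e" using appr by blast
    then show "\<exists>R\<in>D. onorm (\<theta> T - R) < e"
      using onorm_hom_diff_le[OF TC S(1)] by (meson le_less_trans)
  qed
  with TC show "T \<in> {T \<in> C. \<theta> T \<in> D}" by simp
qed (auto simp: op_algebraD[OF C_op_algebra] op_algebraD[OF closed_op_algebra_op_algebra[OF D]]
    hom_zero hom_add hom_comp hom_scale)

end

lemma star_rep_image_cstar_gen:
  fixes S :: "('a::chilbert_space \<Rightarrow> 'a) set" and \<theta> :: "('a \<Rightarrow> 'a) \<Rightarrow> 'b::chilbert_space \<Rightarrow> 'b"
  assumes S: "S \<subseteq> Collect bdd_op" and \<theta>: "star_rep (cstar_gen S) \<theta>"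
    and bdd: "\<theta> ` S \<subseteq> Collect bdd_op"
  shows "\<theta> ` cstar_gen S \<subseteq> cstar_gen (\<theta> ` S)"
proof -
  interpret star_representation "cstar_gen S" \<theta>
    by unfold_locales (rule cstar_subalg_cstar_gen[OF S], rule \<theta>)
  let ?D = "cstar_gen (\<theta> ` S)"
  have D: "cstar_subalg ?D" by (rule cstar_subalg_cstar_gen[OF bdd])
  have "cstar_gen S \<subseteq> {T \<in> cstar_gen S. \<theta> T \<in> ?D}"
  proof (rule cstar_gen_subset_closed_op_algebra)
    show "closed_op_algebra {T \<in> cstar_gen S. \<theta> T \<in> ?D}"
      by (rule closed_op_algebra_preimage[OF cstar_subalg_closed[OF D]])
    fix T assume T: "T \<in> S"
    then have "T \<in> cstar_gen S" by (rule subsetD[OF cstar_gen_superset])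
    moreover have "\<theta> T \<in> ?D" by (rule subsetD[OF cstar_gen_superset imageI[OF T]])
    ultimately show "T \<in> {T \<in> cstar_gen S. \<theta> T \<in> ?D} \<and> adj T \<in> {T \<in> cstar_gen S. \<theta> T \<in> ?D}"
      by (simp add: hom_adj C_adj cstar_subalg_adj[OF D])
  qed
  then show ?thesis by blast
qed

section \<open>Algebras with finite-dimensional range\<close>

lemma fin_dim_range_mono: "S \<subseteq> S' \<Longrightarrow> fin_dim_range S' \<Longrightarrow> fin_dim_range S"
  unfolding fin_dim_range_def by blast

lemma closed_op_algebra_annihilator: "closed_op_algebra {T. bdd_op T \<and> (\<forall>y\<in>Y. T y = 0)}"
proof (rule closed_op_algebraI)
  fix T assume T: "bdd_op T"
    and appr: "\<And>e. e > 0 \<Longrightarrow> \<exists>S\<in>{T. bdd_op T \<and> (\<forall>y\<in>Y. T y = 0)}. onorm (T - S) < e"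
  have "T y = 0" if y: "y \<in> Y" for y
  proof -
    have "norm (T y) \<le> 0 + e" if "e > 0" for e
    proof -
      obtain S where S: "bdd_op S" "S y = 0" "onorm (T - S) * norm y < e"
        using norm_approx_imp_pointwise_approx[OF appr \<open>e > 0\<close>, of y] y by blast
      then show ?thesis using bdd_op_norm_le[OF bdd_op_diff[OF T S(1)], of y] by simp
    qed
    then have "norm (T y) \<le> 0" by (rule field_le_epsilon)
    then show ?thesis by simp
  qed
  with T show "T \<in> {T. bdd_op T \<and> (\<forall>y\<in>Y. T y = 0)}" by simp
qed (auto simp: bdd_op_zero bdd_op_op_add bdd_op_comp bdd_op_op_scale linear_0[OF bdd_op_linear])

text \<open>The closed span of the ranges of a self-adjoint set of operators is the orthogonal complement of
  the common kernel, which does not change on passing to the generated C*-algebra.\<close>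

lemma fin_dim_range_cstar_gen:
  fixes S :: "('a::chilbert_space \<Rightarrow> 'a) set"
  assumes bdd: "S \<subseteq> Collect bdd_op" and adj: "\<And>T. T \<in> S \<Longrightarrow> adj T \<in> S" and fin: "fin_dim_range S"
  shows "fin_dim_range (cstar_gen S)"
proof -
  obtain F where F: "finite F" and range: "\<And>T h. T \<in> S \<Longrightarrow> T h \<in> cspan F"
    using fin unfolding fin_dim_range_def by blast
  define Y where "Y = {y. \<forall>f\<in>F. cinner f y = 0}"
  have orth: "cinner x y = 0" if "x \<in> cspan F" "y \<in> Y" for x y
    using that by (auto simp: cspan_def Y_def cinner.sum_left cinner_scaleC_left)
  have kernel: "T y = 0" if T: "T \<in> S" and y: "y \<in> Y" for T y
  proof -
    have "cinner (adj T (T y)) y = cinner (T y) (T y)"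
      using bdd T by (intro cinner_adj_left) auto
    then show ?thesis using orth[OF range[OF adj[OF T]] y] by (simp add: cinner_self)
  qed
  have "cstar_gen S \<subseteq> {T. bdd_op T \<and> (\<forall>y\<in>Y. T y = 0)}"
    using bdd by (intro cstar_gen_subset_closed_op_algebra closed_op_algebra_annihilator)
      (auto simp: kernel adj bdd_op_adj)
  then have gen: "T y = 0" if "T \<in> cstar_gen S" "y \<in> Y" for T y using that by blast
  have C: "cstar_subalg (cstar_gen S)" by (rule cstar_subalg_cstar_gen[OF bdd])
  have "T h \<in> cspan F" if T: "T \<in> cstar_gen S" for T h
  proof (rule in_cspanI_biorthogonal[OF F])
    fix y assume "\<And>f. f \<in> F \<Longrightarrow> cinner f y = 0"
    then have "adj T y = 0" using gen cstar_subalg_adj[OF C T] by (simp add: Y_def)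
    then show "cinner (T h) y = 0"
      using cinner_adj_right[OF cstar_subalg_bdd[OF C T], of h y] by (simp add: cinner.zero_right)
  qed
  then show ?thesis unfolding fin_dim_range_def using F by blast
qed

section \<open>Strong limits of *-representations\<close>

lemma strong_tendsto_comp:
  fixes S :: "'i \<Rightarrow> 'a::complex_inner \<Rightarrow> 'a"
  assumes bdd: "\<And>i. bdd_op (S i)" and bound: "\<And>i. onorm (S i) \<le> K"
    and S: "\<And>x. ((\<lambda>i. S i x) \<longlongrightarrow> S' x) F" and y: "(y \<longlongrightarrow> y') F"
  shows "((\<lambda>i. S i (y i)) \<longlongrightarrow> S' y') F"
proof -
  have diff: "norm (S i (y i) - S i y') \<le> K * norm (y i - y')" for i
    using bdd_op_norm_le[OF bdd[of i], of "y i - y'"]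
      mult_right_mono[OF bound[of i], of "norm (y i - y')"]
    by (simp add: linear_diff[OF bdd_op_linear[OF bdd]])
  have null: "((\<lambda>i. K * norm (y i - y')) \<longlongrightarrow> 0) F"
    by (intro tendsto_mult_right_zero tendsto_norm_zero LIM_zero y)
  have "((\<lambda>i. S i (y i) - S i y') \<longlongrightarrow> 0) F"
    by (rule Lim_null_comparison[OF always_eventually null]) (simp add: diff)
  from tendsto_add[OF this S[of y']] show ?thesis by simp
qed

lemma strong_limit_of_norm_approx:
  fixes C :: "('a::chilbert_space \<Rightarrow> 'a) set" and \<pi> :: "'i \<Rightarrow> ('a \<Rightarrow> 'a) \<Rightarrow> 'b::chilbert_space \<Rightarrow> 'b"
  assumes C: "cstar_subalg C" and \<theta>: "star_rep C \<theta>" and \<pi>: "\<And>i. star_rep C (\<pi> i)" and T: "T \<in> C"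
    and appr: "\<And>e. e > 0 \<Longrightarrow> \<exists>S\<in>{S \<in> C. ((\<lambda>i. \<pi> i S h) \<longlongrightarrow> \<theta> S h) F}. onorm (T - S) < e"
  shows "((\<lambda>i. \<pi> i T h) \<longlongrightarrow> \<theta> T h) F"
proof (rule tendstoI)
  fix e :: real assume e: "e > 0"
  then have "e / 3 > 0" by simp
  then obtain S where S: "S \<in> C" "((\<lambda>i. \<pi> i S h) \<longlongrightarrow> \<theta> S h) F" "onorm (T - S) * norm h < e / 3"
    using norm_approx_imp_pointwise_approx[OF appr] by blast
  have close: "norm (\<phi> T h - \<phi> S h) \<le> e / 3" if "star_rep C \<phi>" for \<phi>
  proof -
    interpret \<phi>: star_representation C \<phi> using C that by unfold_locales
    have "norm ((\<phi> T - \<phi> S) h) \<le> onorm (\<phi> T - \<phi> S) * norm h"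
      by (intro bdd_op_norm_le bdd_op_diff \<phi>.hom_bdd T S)
    also have "\<dots> \<le> onorm (T - S) * norm h"
      by (intro mult_right_mono \<phi>.onorm_hom_diff_le T S) simp
    finally show ?thesis using S(3) by simp
  qed
  have "\<forall>\<^sub>F i in F. norm (\<pi> i S h - \<theta> S h) < e / 3"
    using tendstoD[OF S(2), of "e / 3"] e by (simp add: dist_norm)
  then show "\<forall>\<^sub>F i in F. dist (\<pi> i T h) (\<theta> T h) < e"
  proof eventually_elim
    case (elim i)
    have "dist (\<pi> i T h) (\<theta> T h)
        \<le> norm (\<pi> i T h - \<pi> i S h) + norm (\<pi> i S h - \<theta> S h) + norm (\<theta> T h - \<theta> S h)"
      unfolding dist_norm by norm
    then show ?case using elim close[OF \<pi>, of i] close[OF \<theta>] by simp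
  qed
qed

lemma closed_op_algebra_strong_limit:
  fixes C :: "('a::chilbert_space \<Rightarrow> 'a) set" and \<pi> :: "'i \<Rightarrow> ('a \<Rightarrow> 'a) \<Rightarrow> 'b::chilbert_space \<Rightarrow> 'b"
  assumes C: "cstar_subalg C" and \<theta>: "star_rep C \<theta>" and \<pi>: "\<And>i. star_rep C (\<pi> i)"
  shows "closed_op_algebra {T \<in> C. \<forall>h. ((\<lambda>i. \<pi> i T h) \<longlongrightarrow> \<theta> T h) F}" (is "closed_op_algebra ?L")
proof (rule closed_op_algebraI)
  interpret \<theta>: star_representation C \<theta> using C \<theta> by unfold_locales
  interpret \<pi>: star_representation C "\<pi> i" for i using C \<pi> by unfold_locales
  note alg = cstar_subalg_op_algebra[OF C]
  show "bdd_op T" if "T \<in> ?L" for T using that op_algebra_bdd[OF alg] by blast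
  show "(\<lambda>x. 0) \<in> ?L" by (simp add: op_algebra_zero[OF alg] \<theta>.hom_zero \<pi>.hom_zero)
  show "op_add S T \<in> ?L" if "S \<in> ?L" "T \<in> ?L" for S T
    using that by (simp add: op_algebra_add[OF alg] \<theta>.hom_add \<pi>.hom_add tendsto_add)
  show "op_scale c T \<in> ?L" if "T \<in> ?L" for c T
    using that
    by (simp add: op_algebra_scale[OF alg] \<theta>.hom_scale \<pi>.hom_scale
        bounded_linear.tendsto[OF bounded_linear_scaleC])
  show "S \<circ> T \<in> ?L" if S: "S \<in> ?L" and T: "T \<in> ?L" for S T
  proof -
    have "((\<lambda>i. \<pi> i S (\<pi> i T h)) \<longlongrightarrow> \<theta> S (\<theta> T h)) F" for h
    proof (rule strong_tendsto_comp[where S = "\<lambda>i. \<pi> i S" and S' = "\<theta> S"])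
      show "bdd_op (\<pi> i S)" "onorm (\<pi> i S) \<le> onorm S" for i
        using S by (simp_all add: \<pi>.hom_bdd \<pi>.onorm_hom_le)
    qed (use S T in simp_all)
    then show ?thesis
      using S T by (simp add: op_algebra_comp[OF alg] \<theta>.hom_comp \<pi>.hom_comp)
  qed
  fix T assume T: "bdd_op T" and appr: "\<And>e. e > 0 \<Longrightarrow> \<exists>S\<in>?L. onorm (T - S) < e"
  have TC: "T \<in> C" by (rule closed_op_algebra_limit[OF \<theta>.C_closed T]) (use appr in blast)
  moreover have "((\<lambda>i. \<pi> i T h) \<longlongrightarrow> \<theta> T h) F" for h
    by (rule strong_limit_of_norm_approx[OF C \<theta> \<pi> TC]) (use appr in blast)
  ultimately show "T \<in> ?L" by simp
qed

section \<open>Approximations of representations and of their lifts\<close>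

lemma star_RFDI:
  assumes "F \<noteq> bot" "\<forall>\<^sub>F i in F. representation A (r i) \<and> fin_dim_range (cstar_gen (r i ` A))"
    and "\<And>T h. T \<in> A \<Longrightarrow> ((\<lambda>i. r i T h) \<longlongrightarrow> \<rho> T h) F"
    and "\<And>T h. T \<in> A \<Longrightarrow> ((\<lambda>i. adj (r i T) h) \<longlongrightarrow> adj (\<rho> T) h) F"
  shows "star_RFD A \<rho>"
  unfolding star_RFD_def using assms
  by (intro exI[of _ "filtermap r F"])
     (simp add: filtermap_bot_iff eventually_filtermap filterlim_filtermap)

lemma RFD_star_repI:
  assumes "F \<noteq> bot" "\<forall>\<^sub>F i in F. star_rep C (p i) \<and> fin_dim_range (p i ` C)"
    and "\<And>T h. T \<in> C \<Longrightarrow> ((\<lambda>i. p i T h) \<longlongrightarrow> \<pi> T h) F"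
  shows "RFD_star_rep C \<pi>"
  unfolding RFD_star_rep_def using assms
  by (intro exI[of _ "filtermap p F"])
     (simp add: filtermap_bot_iff eventually_filtermap filterlim_filtermap)

locale cstar_cover =
  fixes A :: "('k::chilbert_space \<Rightarrow> 'k) set" and C :: "('m::chilbert_space \<Rightarrow> 'm) set"
    and \<mu> :: "('k \<Rightarrow> 'k) \<Rightarrow> 'm \<Rightarrow> 'm"
  assumes compl_isometric: "compl_isometric_rep A \<mu>" and generated: "C = cstar_gen (\<mu> ` A)"
begin

lemma generators_bdd: "\<mu> ` A \<subseteq> Collect bdd_op"
  using compl_isometric by (auto simp: compl_isometric_rep_def)

lemma C_cstar: "cstar_subalg C"
  unfolding generated by (rule cstar_subalg_cstar_gen[OF generators_bdd])

lemma generator_mem: "T \<in> A \<Longrightarrow> \<mu> T \<in> C"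
  unfolding generated by (intro subsetD[OF cstar_gen_superset] imageI)

lemma generator_adj_mem: "T \<in> A \<Longrightarrow> adj (\<mu> T) \<in> C"
  by (rule cstar_subalg_adj[OF C_cstar generator_mem])

lemma representation_comp:
  fixes p :: "('m \<Rightarrow> 'm) \<Rightarrow> 'h::chilbert_space \<Rightarrow> 'h"
  assumes "star_rep C p"
  shows "representation A (p \<circ> \<mu>)"
proof -
  interpret p: star_representation C p using C_cstar assms by unfold_locales
  have "alg_hom A (p \<circ> \<mu>)"
    using compl_isometric
    by (simp add: alg_hom_def compl_isometric_rep_def generator_mem
        p.hom_add p.hom_comp p.hom_scale)
  moreover have "mat_norm n (\<lambda>i j. (p \<circ> \<mu>) (M i j)) \<le> mat_norm n M"
    if M: "\<forall>i<n. \<forall>j<n. M i j \<in> A" for n M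
  proof -
    have "mat_norm n (\<lambda>i j. p (\<mu> (M i j))) \<le> mat_norm n (\<lambda>i j. \<mu> (M i j))"
      using M by (intro p.mat_norm_amplify_le matrices_overI generator_mem) blast
    also have "\<dots> = mat_norm n M" using compl_isometric M by (simp add: compl_isometric_rep_def)
    finally show ?thesis by simp
  qed
  ultimately show ?thesis by (simp add: representation_def p.hom_bdd generator_mem)
qed

lemma fin_dim_range_comp:
  fixes p :: "('m \<Rightarrow> 'm) \<Rightarrow> 'h::chilbert_space \<Rightarrow> 'h"
  assumes "star_rep C p" and fin: "fin_dim_range (p ` C)"
  shows "fin_dim_range (cstar_gen ((p \<circ> \<mu>) ` A))"
proof -
  interpret p: star_representation C p using C_cstar assms(1) by unfold_locales
  have "fin_dim_range (cstar_gen (p ` C))"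
    by (rule fin_dim_range_cstar_gen[OF _ _ fin])
       (auto simp: p.hom_bdd p.C_adj simp flip: p.hom_adj)
  moreover have "cstar_gen ((p \<circ> \<mu>) ` A) \<subseteq> cstar_gen (p ` C)"
    by (rule cstar_gen_mono) (auto simp: generator_mem)
  ultimately show ?thesis by (rule fin_dim_range_mono[rotated])
qed

lemma fin_dim_range_lift:
  fixes p :: "('m \<Rightarrow> 'm) \<Rightarrow> 'h::chilbert_space \<Rightarrow> 'h"
  assumes "star_rep C p" and lift: "\<And>T. T \<in> A \<Longrightarrow> p (\<mu> T) = r T"
    and fin: "fin_dim_range (cstar_gen (r ` A))"
  shows "fin_dim_range (p ` C)"
proof -
  interpret p: star_representation C p using C_cstar assms(1) by unfold_locales
  have "p ` C \<subseteq> cstar_gen (p ` \<mu> ` A)"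
    using assms(1) p.hom_bdd generator_mem unfolding generated
    by (intro star_rep_image_cstar_gen generators_bdd) auto
  also have "p ` \<mu> ` A = r ` A" by (simp add: image_image lift)
  finally show ?thesis using fin by (rule fin_dim_range_mono)
qed

lemma strong_limit_from_generators:
  fixes \<theta> :: "('m \<Rightarrow> 'm) \<Rightarrow> 'h::chilbert_space \<Rightarrow> 'h"
  assumes "star_rep C \<theta>" "\<And>i. star_rep C (\<pi> i)"
    and lim: "\<And>T h. T \<in> A \<Longrightarrow> ((\<lambda>i. \<pi> i (\<mu> T) h) \<longlongrightarrow> \<theta> (\<mu> T) h) F"
    and lim_adj: "\<And>T h. T \<in> A \<Longrightarrow> ((\<lambda>i. adj (\<pi> i (\<mu> T)) h) \<longlongrightarrow> adj (\<theta> (\<mu> T)) h) F"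
    and T: "T \<in> C"
  shows "((\<lambda>i. \<pi> i T h) \<longlongrightarrow> \<theta> T h) F"
proof -
  interpret \<theta>: star_representation C \<theta> using C_cstar assms(1) by unfold_locales
  interpret \<pi>: star_representation C "\<pi> i" for i using C_cstar assms(2) by unfold_locales
  have "C \<subseteq> {T \<in> C. \<forall>h. ((\<lambda>i. \<pi> i T h) \<longlongrightarrow> \<theta> T h) F}" (is "_ \<subseteq> ?L")
  proof -
    have "\<mu> T \<in> ?L \<and> adj (\<mu> T) \<in> ?L" if "T \<in> A" for T
      using that by (simp add: generator_mem generator_adj_mem \<theta>.hom_adj \<pi>.hom_adj lim lim_adj)
    then have "cstar_gen (\<mu> ` A) \<subseteq> ?L"
      by (intro cstar_gen_subset_closed_op_algebra closed_op_algebra_strong_limit C_cstar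
          assms(1,2)) blast
    then show ?thesis by (simp add: generated)
  qed
  with T show ?thesis by blast
qed

lemma RFD_star_rep_imp_star_RFD:
  fixes \<theta> :: "('m \<Rightarrow> 'm) \<Rightarrow> 'h::chilbert_space \<Rightarrow> 'h"
  assumes \<theta>: "star_rep C \<theta>" and RFD: "RFD_star_rep C \<theta>"
  shows "star_RFD A (\<theta> \<circ> \<mu>)"
proof -
  obtain F where "F \<noteq> bot"
    and fin: "\<forall>\<^sub>F p in F. star_rep C p \<and> fin_dim_range (p ` C)"
    and lim: "\<And>T h. T \<in> C \<Longrightarrow> ((\<lambda>p. p T h) \<longlongrightarrow> \<theta> T h) F"
    using RFD unfolding RFD_star_rep_def by blast
  show ?thesis
  proof (rule star_RFDI[where r = "\<lambda>p. p \<circ> \<mu>", OF \<open>F \<noteq> bot\<close>])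
    show "\<forall>\<^sub>F p in F. representation A (p \<circ> \<mu>) \<and> fin_dim_range (cstar_gen ((p \<circ> \<mu>) ` A))"
      using fin by eventually_elim (blast intro: representation_comp fin_dim_range_comp)
    fix T h assume T: "T \<in> A"
    show "((\<lambda>p. (p \<circ> \<mu>) T h) \<longlongrightarrow> (\<theta> \<circ> \<mu>) T h) F"
      using lim[OF generator_mem[OF T]] by simp
    show "((\<lambda>p. adj ((p \<circ> \<mu>) T) h) \<longlongrightarrow> adj ((\<theta> \<circ> \<mu>) T) h) F"
    proof (rule Lim_transform_eventually)
      show "((\<lambda>p. p (adj (\<mu> T)) h) \<longlongrightarrow> adj ((\<theta> \<circ> \<mu>) T) h) F"
        using lim[OF generator_adj_mem[OF T]] \<theta> generator_mem[OF T] by (simp add: star_rep_def)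
      show "\<forall>\<^sub>F p in F. p (adj (\<mu> T)) h = adj ((p \<circ> \<mu>) T) h"
        using fin by eventually_elim (simp add: star_rep_def generator_mem[OF T])
    qed
  qed
qed

lemma star_RFD_imp_RFD_star_rep:
  fixes \<theta> :: "('m \<Rightarrow> 'm) \<Rightarrow> 'h::chilbert_space \<Rightarrow> 'h"
  assumes lift: "\<And>r :: ('k \<Rightarrow> 'k) \<Rightarrow> 'h \<Rightarrow> 'h. representation A r \<Longrightarrow>
      \<exists>p. star_rep C p \<and> (\<forall>T\<in>A. p (\<mu> T) = r T)"
    and \<theta>: "star_rep C \<theta>" and RFD: "star_RFD A (\<theta> \<circ> \<mu>)"
  shows "RFD_star_rep C \<theta>"
proof -
  obtain F where "F \<noteq> bot"
    and fin: "\<forall>\<^sub>F r in F. representation A r \<and> fin_dim_range (cstar_gen (r ` A))"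
    and lim: "\<And>T h. T \<in> A \<Longrightarrow> ((\<lambda>r. r T h) \<longlongrightarrow> \<theta> (\<mu> T) h) F"
    and lim_adj: "\<And>T h. T \<in> A \<Longrightarrow> ((\<lambda>r. adj (r T) h) \<longlongrightarrow> adj (\<theta> (\<mu> T)) h) F"
    using RFD unfolding star_RFD_def o_apply by blast
  have "\<exists>p. star_rep C p \<and> (representation A r \<longrightarrow> (\<forall>T\<in>A. p (\<mu> T) = r T))"
    for r :: "('k \<Rightarrow> 'k) \<Rightarrow> 'h \<Rightarrow> 'h"
    using lift[of r] \<theta> by blast
  then obtain L :: "(('k \<Rightarrow> 'k) \<Rightarrow> 'h \<Rightarrow> 'h) \<Rightarrow> ('m \<Rightarrow> 'm) \<Rightarrow> 'h \<Rightarrow> 'h"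
    where L: "\<And>r. star_rep C (L r)" "\<And>r T. representation A r \<Longrightarrow> T \<in> A \<Longrightarrow> L r (\<mu> T) = r T"
    by metis
  show ?thesis
  proof (rule RFD_star_repI[OF \<open>F \<noteq> bot\<close>])
    show "\<forall>\<^sub>F r in F. star_rep C (L r) \<and> fin_dim_range (L r ` C)"
      using fin by eventually_elim (blast intro: L fin_dim_range_lift)
    fix T h assume "T \<in> C"
    then show "((\<lambda>r. L r T h) \<longlongrightarrow> \<theta> T h) F"
    proof (rule strong_limit_from_generators[OF \<theta> L(1), rotated 2])
      fix T h assume T: "T \<in> A"
      have eq: "\<forall>\<^sub>F r in F. r T = L r (\<mu> T)"
        using fin by eventually_elim (simp add: L T)
      show "((\<lambda>r. L r (\<mu> T) h) \<longlongrightarrow> \<theta> (\<mu> T) h) F"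
        by (rule Lim_transform_eventually[OF lim[OF T]]) (use eq in eventually_elim, simp)
      show "((\<lambda>r. adj (L r (\<mu> T)) h) \<longlongrightarrow> adj (\<theta> (\<mu> T)) h) F"
        by (rule Lim_transform_eventually[OF lim_adj[OF T]]) (use eq in eventually_elim, simp)
    qed
  qed
qed

end

lemma
  assumes "max_cstar_cover A C \<mu> TYPE('h::chilbert_space)"
  shows max_cstar_cover_cstar_cover: "cstar_cover A C \<mu>"
    and max_cstar_cover_lift: "\<And>r :: _ \<Rightarrow> 'h \<Rightarrow> 'h. representation A r \<Longrightarrow>
      \<exists>p. star_rep C p \<and> (\<forall>T\<in>A. p (\<mu> T) = r T)"
proof -
  show "cstar_cover A C \<mu>"
    using assms unfolding max_cstar_cover_def by (elim conjE) unfold_locales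
  show "\<exists>p. star_rep C p \<and> (\<forall>T\<in>A. p (\<mu> T) = r T)" if "representation A r" for r :: "_ \<Rightarrow> 'h \<Rightarrow> 'h"
    using assms that unfolding max_cstar_cover_def
    by (elim conjE) (drule spec, drule (1) mp, erule conjunct1)
qed

lemma star_RFD_cong:
  assumes "\<And>T. T \<in> A \<Longrightarrow> \<rho> T = \<rho>' T"
  shows "star_RFD A \<rho> \<longleftrightarrow> star_RFD A \<rho>'"
  unfolding star_RFD_def by (simp add: assms)

theorem theorem5p4:
  fixes A :: "('k::chilbert_space \<Rightarrow> 'k) set"
    and C :: "('m::chilbert_space \<Rightarrow> 'm) set"
    and \<mu> :: "('k \<Rightarrow> 'k) \<Rightarrow> ('m \<Rightarrow> 'm)"
    and \<rho> :: "('k \<Rightarrow> 'k) \<Rightarrow> ('h::chilbert_space \<Rightarrow> 'h)"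
    and \<theta> :: "('m \<Rightarrow> 'm) \<Rightarrow> ('h \<Rightarrow> 'h)"
  assumes "op_algebra A"
    and "max_cstar_cover A C \<mu> TYPE('h)"
    and "representation A \<rho>"
    and "star_rep C \<theta>"
    and "\<forall>T\<in>A. \<theta> (\<mu> T) = \<rho> T"
  shows "star_RFD A \<rho> \<longleftrightarrow> RFD_star_rep C \<theta>"
proof -
  interpret cstar_cover A C \<mu> by (rule max_cstar_cover_cstar_cover[OF assms(2)])
  have "star_RFD A \<rho> \<longleftrightarrow> star_RFD A (\<theta> \<circ> \<mu>)"
    by (rule star_RFD_cong) (simp add: assms(5))
  also have "\<dots> \<longleftrightarrow> RFD_star_rep C \<theta>"
    using star_RFD_imp_RFD_star_rep[OF max_cstar_cover_lift[OF assms(2)] assms(4)]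
      RFD_star_rep_imp_star_RFD[OF assms(4)] by blast
  finally show ?thesis .
qed

end
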